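(* Let $K$ be a field of characteristic zero, $A$ a commutative associative unital $K$-algebra, $(G,\rho)$ a Lie--Rinehart algebra over $A$, and $\mathcal G=\bigwedge_AG$ with its Schouten--Nijenhuis bracket $[\cdot,\cdot]_{SN}$. For homogeneous $P\in\mathcal G^p$, $Q\in\mathcal G^q$, $R\in\mathcal G^r$, \[ [P,Q\wedge R]_{SN}=[P,Q]_{SN}\wedge R+(-1)^{(p-1)q}Q\wedge[P,R]_{SN}. \] Consequently, \[ [P\wedge Q,R]_{SN}=P\wedge[Q,R]_{SN}+(-1)^{q(r-1)}[P,R]_{SN}\wedge Q. \]
   Context: A Lie--Rinehart algebra over $A$ is an $A$-module $G$ endowed with a $K$-Lie bracket $[\cdot,\cdot]$ and an $A$-linear map $\rho:G\to\operatorname{Der}_K(A)$ (the anchor) that is a morphism of $K$-Lie algebras, such that $[x,ay]=a[x,y]+\rho(x)(a)y$ for all $a\in A$, $x,y\in G$. $\mathcal G=\bigwedge_AG=\bigoplus_{p\ge0}\mathcal G^p$ is the exterior algebra over $A$, $\mathcal G^p=\bigwedge_A^pG$, with $\mathcal G^0=A$, $\mathcal G^1=G$ and $\mathcal G^p=0$ for $p<0$. The Schouten--Nijenhuis bracket $[\cdot,\cdot]_{SN}$ is the (well-defined) $K$-bilinear map $\mathcal G\times\mathcal G\to\mathcal G$ given on decomposable elements as follows. For $X=x_1\wedge\cdots\wedge x_p$ and $Y=y_1\wedge\cdots\wedge y_q$ with $x_i,y_j\in G$, let $\widehat X_i$ be $X$ with the factor $x_i$ omitted ($\widehat X_1=1$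 if $p=1$), and similarly $\widehat Y_j$. For $p,q\ge1$, \[ [X,Y]_{SN}=\sum_{i=1}^p\sum_{j=1}^q(-1)^{i+j}[x_i,y_j]\wedge\widehat X_i\wedge\widehat Y_j . \] For $a\in A$ and $p\ge1$, \[ [X,a]_{SN}=\sum_{i=1}^p(-1)^{p-i}\rho(x_i)(a)\,\widehat X_i,\qquad [a,X]_{SN}=\sum_{i=1}^p(-1)^{i}\rho(x_i)(a)\,\widehat X_i . \] For $a,b\in A$, $[a,b]_{SN}=0$. *)

theory Defs
  imports
    "HOL-Library.Poly_Mapping"
    "HOL-Algebra.QuotRing"
    "HOL-Algebra.Algebraic_Closure_Type"
begin

section \<open>Lie--Rinehart algebras\<close>

locale comm_algebra = vector_space scaleK
  for scaleK :: "'k::field \<Rightarrow> 'a::comm_ring_1 \<Rightarrow> 'a" +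
  assumes scaleK_mult_left: "scaleK c (a * b) = scaleK c a * b"

definition is_derivation :: "('k::field \<Rightarrow> 'a::comm_ring_1 \<Rightarrow> 'a) \<Rightarrow> ('a \<Rightarrow> 'a) \<Rightarrow> bool" where
  "is_derivation scaleK D \<longleftrightarrow>
     Vector_Spaces.linear scaleK scaleK D \<and> (\<forall>a b. D (a * b) = a * D b + D a * b)"

locale lie_algebra = vector_space scale
  for scale :: "'k::field \<Rightarrow> 'g::ab_group_add \<Rightarrow> 'g" +
  fixes lie :: "'g \<Rightarrow> 'g \<Rightarrow> 'g"
  assumes lie_linear_left: "Vector_Spaces.linear scale scale (\<lambda>x. lie x y)"
    and lie_linear_right: "Vector_Spaces.linear scale scale (lie x)"
    and lie_alternating: "lie x x = 0"
    and lie_jacobi: "lie x (lie y z) + lie y (lie z x) + lie z (lie x y) = 0"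

text \<open>
  \<open>K\<close> acts on the \<open>A\<close>-module \<open>G\<close> through the structure map \<open>c \<mapsto> scaleK c 1\<close>.
  (\<open>Modules.module\<close> is the module locale of the HOL type classes; the unqualified name
  denotes the one of HOL-Algebra.)
\<close>
locale lie_rinehart =
  A: comm_algebra scaleK + G: Modules.module scaleA + L: lie_algebra "\<lambda>c. scaleA (scaleK c 1)" lie
  for scaleK :: "'k::field \<Rightarrow> 'a::comm_ring_1 \<Rightarrow> 'a"
    and scaleA :: "'a \<Rightarrow> 'g::ab_group_add \<Rightarrow> 'g"
    and lie :: "'g \<Rightarrow> 'g \<Rightarrow> 'g" +
  fixes anchor :: "'g \<Rightarrow> 'a \<Rightarrow> 'a"
  assumes anchor_derivation: "is_derivation scaleK (anchor x)"
    and anchor_add: "anchor (x + y) b = anchor x b + anchor y b"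
    and anchor_scale: "anchor (scaleA a x) b = a * anchor x b"
    and anchor_lie: "anchor (lie x y) b = anchor x (anchor y b) - anchor y (anchor x b)"
    and lie_leibniz: "lie x (scaleA a y) = scaleA a (lie x y) + scaleA (anchor x a) y"


section \<open>The exterior algebra of a module\<close>

text \<open>
  With words (lists) as a monoid under concatenation, the convolution ring
  \<open>'g list \<Rightarrow>\<^sub>0 'a\<close> is the free associative \<open>A\<close>-algebra on the set \<open>G\<close>.
\<close>
instantiation list :: (type) monoid_add
begin
definition zero_list_def: "0 = ([] :: 'a list)"
definition plus_list_def: "xs + ys = (xs @ ys :: 'a list)"
instance by standard (simp_all add: zero_list_def plus_list_def)
end

type_synonym ('g, 'a) free_alg = "'g list \<Rightarrow>\<^sub>0 'a"

abbreviation letter :: "'g \<Rightarrow> ('g, 'a::comm_ring_1) free_alg" where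
  "letter x \<equiv> Poly_Mapping.single [x] 1"

abbreviation const_alg :: "'a::comm_ring_1 \<Rightarrow> ('g, 'a) free_alg" where
  "const_alg a \<equiv> Poly_Mapping.single [] a"

text \<open>
  The first two families of relations cut the free algebra down to the tensor algebra of the
  \<open>A\<close>-module \<open>G\<close>, the third one makes the product alternating.
\<close>
definition exterior_relations ::
    "('a::comm_ring_1 \<Rightarrow> 'g::ab_group_add \<Rightarrow> 'g) \<Rightarrow> ('g, 'a) free_alg set" where
  "exterior_relations scaleA =
     {letter (x + y) - letter x - letter y | x y. True} \<union>
     {letter (scaleA a x) - const_alg a * letter x | a x. True} \<union>
     {letter x * letter x | x. True}"

definition exterior_ideal ::
    "('a::comm_ring_1 \<Rightarrow> 'g::ab_group_add \<Rightarrow> 'g) \<Rightarrow> ('g, 'a) free_alg set" where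
  "exterior_ideal scaleA = genideal ring_of_type_algebra (exterior_relations scaleA)"

definition exterior_algebra ::
    "('a::comm_ring_1 \<Rightarrow> 'g::ab_group_add \<Rightarrow> 'g) \<Rightarrow> ('g, 'a) free_alg set ring" where
  "exterior_algebra scaleA = ring_of_type_algebra Quot exterior_ideal scaleA"

definition ext_class ::
    "('a::comm_ring_1 \<Rightarrow> 'g::ab_group_add \<Rightarrow> 'g) \<Rightarrow> ('g, 'a) free_alg \<Rightarrow> ('g, 'a) free_alg set" where
  "ext_class scaleA f = exterior_ideal scaleA +>\<^bsub>ring_of_type_algebra\<^esub> f"

text \<open>The inclusions of \<open>A\<close> and \<open>G\<close> as the components of degree 0 and 1.\<close>

definition ext_const ::
    "('a::comm_ring_1 \<Rightarrow> 'g::ab_group_add \<Rightarrow> 'g) \<Rightarrow> 'a \<Rightarrow> ('g, 'a) free_alg set" where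
  "ext_const scaleA a = ext_class scaleA (const_alg a)"

definition ext_vec ::
    "('a::comm_ring_1 \<Rightarrow> 'g::ab_group_add \<Rightarrow> 'g) \<Rightarrow> 'g \<Rightarrow> ('g, 'a) free_alg set" where
  "ext_vec scaleA x = ext_class scaleA (letter x)"

text \<open>The degree is an integer, so that the component is zero in negative degree.\<close>
definition ext_degree ::
    "('a::comm_ring_1 \<Rightarrow> 'g::ab_group_add \<Rightarrow> 'g) \<Rightarrow> int \<Rightarrow> ('g, 'a) free_alg set set" where
  "ext_degree scaleA p =
     {ext_class scaleA f | f. \<forall>w\<in>Poly_Mapping.keys f. int (length w) = p}"

definition ext_scale ::
    "('a::comm_ring_1 \<Rightarrow> 'g::ab_group_add \<Rightarrow> 'g) \<Rightarrow> 'a \<Rightarrow>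
     ('g, 'a) free_alg set \<Rightarrow> ('g, 'a) free_alg set" where
  "ext_scale scaleA a U = ext_const scaleA a \<otimes>\<^bsub>exterior_algebra scaleA\<^esub> U"

definition ext_scaleK ::
    "('k::field \<Rightarrow> 'a::comm_ring_1 \<Rightarrow> 'a) \<Rightarrow> ('a \<Rightarrow> 'g::ab_group_add \<Rightarrow> 'g) \<Rightarrow> 'k \<Rightarrow>
     ('g, 'a) free_alg set \<Rightarrow> ('g, 'a) free_alg set" where
  "ext_scaleK scaleK scaleA c U = ext_scale scaleA (scaleK c 1) U"

text \<open>\<open>x\<^sub>1 \<and> \<dots> \<and> x\<^sub>p\<close>, and \<open>1\<close> for the empty list\<close>
definition wedge_list ::
    "('a::comm_ring_1 \<Rightarrow> 'g::ab_group_add \<Rightarrow> 'g) \<Rightarrow> 'g list \<Rightarrow> ('g, 'a) free_alg set" where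
  "wedge_list scaleA xs =
     foldr (\<lambda>x U. ext_vec scaleA x \<otimes>\<^bsub>exterior_algebra scaleA\<^esub> U) xs \<one>\<^bsub>exterior_algebra scaleA\<^esub>"

text \<open>Positions are counted from 1.\<close>
definition omit :: "nat \<Rightarrow> 'g list \<Rightarrow> 'g list" where
  "omit i xs = take (i - 1) xs @ drop i xs"


section \<open>The Schouten--Nijenhuis bracket\<close>

definition ext_K_linear ::
    "('k::field \<Rightarrow> 'a::comm_ring_1 \<Rightarrow> 'a) \<Rightarrow> ('a \<Rightarrow> 'g::ab_group_add \<Rightarrow> 'g) \<Rightarrow>
     (('g, 'a) free_alg set \<Rightarrow> ('g, 'a) free_alg set) \<Rightarrow> bool" where
  "ext_K_linear scaleK scaleA F \<longleftrightarrow> (let E = exterior_algebra scaleA in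
     F \<in> carrier E \<rightarrow> carrier E \<and>
     (\<forall>U\<in>carrier E. \<forall>V\<in>carrier E. F (U \<oplus>\<^bsub>E\<^esub> V) = F U \<oplus>\<^bsub>E\<^esub> F V) \<and>
     (\<forall>c. \<forall>U\<in>carrier E.
        F (ext_scaleK scaleK scaleA c U) = ext_scaleK scaleK scaleA c (F U)))"

definition is_schouten_bracket ::
    "('k::field \<Rightarrow> 'a::comm_ring_1 \<Rightarrow> 'a) \<Rightarrow> ('a \<Rightarrow> 'g::ab_group_add \<Rightarrow> 'g) \<Rightarrow>
     ('g \<Rightarrow> 'g \<Rightarrow> 'g) \<Rightarrow> ('g \<Rightarrow> 'a \<Rightarrow> 'a) \<Rightarrow>
     (('g, 'a) free_alg set \<Rightarrow> ('g, 'a) free_alg set \<Rightarrow> ('g, 'a) free_alg set) \<Rightarrow> bool" where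
  "is_schouten_bracket scaleK scaleA lie anchor B \<longleftrightarrow> (let E = exterior_algebra scaleA in
     (\<forall>U\<in>carrier E. ext_K_linear scaleK scaleA (B U)) \<and>
     (\<forall>V\<in>carrier E. ext_K_linear scaleK scaleA (\<lambda>U. B U V)) \<and>
     (\<forall>xs ys. xs \<noteq> [] \<longrightarrow> ys \<noteq> [] \<longrightarrow>
        B (wedge_list scaleA xs) (wedge_list scaleA ys) =
          (\<Oplus>\<^bsub>E\<^esub>i\<in>{1..length xs}. \<Oplus>\<^bsub>E\<^esub>j\<in>{1..length ys}.
             ext_scale scaleA ((-1) ^ (i + j))
               (ext_vec scaleA (lie (xs ! (i - 1)) (ys ! (j - 1))) \<otimes>\<^bsub>E\<^esub>
                  wedge_list scaleA (omit i xs) \<otimes>\<^bsub>E\<^esub> wedge_list scaleA (omit j ys)))) \<and>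
     (\<forall>xs a. xs \<noteq> [] \<longrightarrow>
        B (wedge_list scaleA xs) (ext_const scaleA a) =
          (\<Oplus>\<^bsub>E\<^esub>i\<in>{1..length xs}.
             ext_scale scaleA ((-1) ^ (length xs - i) * anchor (xs ! (i - 1)) a)
               (wedge_list scaleA (omit i xs)))) \<and>
     (\<forall>xs a. xs \<noteq> [] \<longrightarrow>
        B (ext_const scaleA a) (wedge_list scaleA xs) =
          (\<Oplus>\<^bsub>E\<^esub>i\<in>{1..length xs}.
             ext_scale scaleA ((-1) ^ i * anchor (xs ! (i - 1)) a)
               (wedge_list scaleA (omit i xs)))) \<and>
     (\<forall>a b. B (ext_const scaleA a) (ext_const scaleA b) = \<zero>\<^bsub>E\<^esub>))"

text \<open>
  Elements of \<open>A\<close> and decomposable elements \<open>x\<^sub>1 \<and> \<dots> \<and> x\<^sub>p\<close> span the exterior algebra over \<open>K\<close>,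
  so for a Lie--Rinehart algebra the conditions determine the bracket on the carrier; the choice
  only concerns its irrelevant values elsewhere.
\<close>
definition schouten ::
    "('k::field \<Rightarrow> 'a::comm_ring_1 \<Rightarrow> 'a) \<Rightarrow> ('a \<Rightarrow> 'g::ab_group_add \<Rightarrow> 'g) \<Rightarrow>
     ('g \<Rightarrow> 'g \<Rightarrow> 'g) \<Rightarrow> ('g \<Rightarrow> 'a \<Rightarrow> 'a) \<Rightarrow>
     ('g, 'a) free_alg set \<Rightarrow> ('g, 'a) free_alg set \<Rightarrow> ('g, 'a) free_alg set" where
  "schouten scaleK scaleA lie anchor = (SOME B. is_schouten_bracket scaleK scaleA lie anchor B)"

end

theory Submission
  imports Defs
begin

text \<open>
  For fixed \<open>P\<close>, the formula
  \<open>[P, a y\<^sub>1 \<dots> y\<^sub>q] = [P, a] y\<^sub>1 \<dots> y\<^sub>q + a \<Sum>\<^sub>j (-1)\<^bsup>j-1\<^esup> [P, y\<^sub>j] y\<^sub>1 \<dots> y\<^bsub>j-1\<^esub> y\<^bsub>j+1\<^esub> \<dots> y\<^sub>q\<close>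
  defines a map on the free algebra whose signs do not involve the degree of \<open>P\<close>. It descends to the
  exterior algebra as soon as \<open>[P, \<cdot>]\<close> satisfies the Leibniz rule on \<open>A\<close> and for the products \<open>a y\<close>, and
  then \<open>[P, Q R] = [P, Q] R + (-1)\<^bsup>qr\<^esup> [P, R] Q\<close>, which graded commutativity turns into the first
  identity. Applied first with \<open>P\<close> in \<open>A\<close> or \<open>G\<close>, this principle yields \<open>[a, P]\<close> and \<open>[y, P]\<close> for all \<open>P\<close>;
  these give the values of \<open>[P, \<cdot>]\<close> on generators, and applying the principle once more shows that the
  bracket is well defined. The second identity follows from the first by graded antisymmetry.
\<close>

section \<open>The free algebra\<close>

definition sg :: "int \<Rightarrow> 'a::comm_ring_1" where
  "sg k = (if even k then 1 else -1)"

lemma sg_mult [simp]: "sg a * sg b = sg (a + b)"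
  by (auto simp: sg_def)

lemma sg_mult_left [simp]: "sg a * (sg b * c) = sg (a + b) * c"
  by (simp add: mult.assoc [symmetric])

lemma sg_0 [simp]: "sg 0 = 1"
  by (simp add: sg_def)

lemma sg_eqI: "even (a + b) \<Longrightarrow> sg a = sg b"
  by (auto simp: sg_def)

lemma minus_sg: "- sg a = sg (a + 1)"
  by (auto simp: sg_def)

lemma sg_shift: "sg (a + 1) = - sg a" "sg (1 + a) = - sg a"
  by (auto simp: sg_def)

lemma sg_add_2: "sg (2 + a) = sg a"
  by (simp add: sg_def)

lemma power_minus1_sg: "(- 1) ^ n = sg (int n)"
  by (auto simp: sg_def)

lemma power_int_minus1_sg: "((- 1 :: 'k::field) powi k) = sg k"
  by (cases "even k") (auto simp: sg_def)

text \<open>The \<open>A\<close>-module structure of the free algebra. It is a constant of its own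
  so that simplification can collect coefficients in front of a product.\<close>

definition sm :: "'a::comm_ring_1 \<Rightarrow> ('g, 'a) free_alg \<Rightarrow> ('g, 'a) free_alg" where
  "sm a f = const_alg a * f"

abbreviation wd :: "'g list \<Rightarrow> ('g, 'a::comm_ring_1) free_alg" where
  "wd w \<equiv> Poly_Mapping.single w 1"

lemma single_nil_1 [simp]: "Poly_Mapping.single [] 1 = (1 :: ('g, 'a::comm_ring_1) free_alg)"
  using single_one by (metis zero_list_def)

lemma sm_wd: "sm a (wd w) = Poly_Mapping.single w a"
  by (simp add: sm_def mult_single plus_list_def)

lemma const_alg_eq_sm: "const_alg a = sm a 1"
  by (simp add: sm_def)

lemma wd_mult [simp]: "wd w * wd v = wd (w @ v)"
  by (simp add: mult_single plus_list_def)

lemma sm_add: "sm a (f + g) = sm a f + sm a g"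
  by (simp add: sm_def algebra_simps)

lemma sm_diff: "sm a (f - g) = sm a f - sm a g"
  by (simp add: sm_def algebra_simps)

lemma sm_add_left: "sm (a + b) f = sm a f + sm b f"
  by (simp add: sm_def algebra_simps single_add)

lemma sm_sm [simp]: "sm a (sm b f) = sm (a * b) f"
  by (simp add: sm_def mult.assoc [symmetric] mult_single plus_list_def)

lemma sm_1 [simp]: "sm 1 f = f"
  by (simp add: sm_def)

lemma sm_0 [simp]: "sm a 0 = 0"
  by (simp add: sm_def)

lemma sm_0_left [simp]: "sm 0 f = 0"
  by (simp add: sm_def)

lemma sm_minus [simp]: "sm a (- f) = sm (- a) f"
  by (simp add: sm_def single_uminus)

lemma minus_sm: "- sm a f = sm (- a) f"
  by (simp add: sm_def single_uminus)

lemma sm_mult_left [simp]: "sm a f * g = sm a (f * g)"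
  by (simp add: sm_def mult.assoc)

lemma sm_sum: "sm a (sum f S) = (\<Sum>i\<in>S. sm a (f i))"
  by (simp add: sm_def sum_distrib_left)

lemma poly_mapping_decomp: "f = (\<Sum>w\<in>Poly_Mapping.keys f. sm (Poly_Mapping.lookup f w) (wd w))"
  by (rule poly_mapping_eqI)
    (auto simp: sm_wd lookup_sum lookup_single when_def in_keys_iff sum.If_cases
      intro!: sum.neutral)

text \<open>Every element is the sum of the monomials over its own support, so the monomial case may
  assume that the word occurs in \<open>f\<close>. This makes the induction for homogeneous elements
  a special case.\<close>

lemma free_alg_induct [case_names zero mono add]:
  assumes "P 0" and "\<And>a w. w \<in> Poly_Mapping.keys f \<Longrightarrow> P (sm a (wd w))" and "\<And>f g. P f \<Longrightarrow> P g \<Longrightarrow> P (f + g)"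
  shows "P f"
proof -
  have "P (\<Sum>w\<in>S. sm (Poly_Mapping.lookup f w) (wd w))" if "S \<subseteq> Poly_Mapping.keys f" for S
    using finite_subset [OF that finite_keys] that
    by (induction S rule: finite_induct) (auto intro: assms)
  from this [of "Poly_Mapping.keys f"] show ?thesis
    using poly_mapping_decomp [of f] by simp
qed

text \<open>Coefficients are central: \<open>A\<close> is commutative and the empty word is
  neutral.\<close>

lemma sm_mult_right [simp]: "f * sm a g = sm a (f * g)"
proof (induction f rule: free_alg_induct)
  case (mono b w)
  have "wd w * sm a g = sm a (wd w * g)"
    by (simp add: sm_def mult.assoc [symmetric] mult_single plus_list_def)
  then show ?case by (simp add: mult.commute)
qed (simp_all add: distrib_right sm_add)

section \<open>Homogeneous elements and extension of maps from monomials\<close>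

definition homog :: "int \<Rightarrow> ('g, 'a::comm_ring_1) free_alg \<Rightarrow> bool" where
  "homog d f \<longleftrightarrow> (\<forall>w\<in>Poly_Mapping.keys f. int (length w) = d)"

lemma homog_0 [simp]: "homog d 0"
  by (simp add: homog_def)

lemma homog_wd [simp]: "int (length w) = d \<Longrightarrow> homog d (wd w)"
  by (simp add: homog_def)

lemma homog_add: "homog d f \<Longrightarrow> homog d g \<Longrightarrow> homog d (f + g)"
  unfolding homog_def using keys_add [of f g] by blast

lemma homog_mult: "homog d f \<Longrightarrow> homog e g \<Longrightarrow> homog (d + e) (f * g)"
  unfolding homog_def using keys_mult [of f g]
  by (fastforce simp: plus_list_def)

lemma homog_sm: "homog d f \<Longrightarrow> homog d (sm a f)"
  using homog_mult [of 0 "const_alg a" d f] by (simp add: sm_def homog_def [of 0])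

lemma homog_minus: "homog d f \<Longrightarrow> homog d (- f)"
  by (simp add: homog_def)

lemma homog_sum: "(\<And>i. i \<in> S \<Longrightarrow> homog d (f i)) \<Longrightarrow> homog d (sum f S)"
  by (induction S rule: infinite_finite_induct) (auto intro: homog_add)

lemma homog_induct [consumes 1, case_names zero mono add]:
  assumes "homog d f" "P 0" "\<And>a w. int (length w) = d \<Longrightarrow> P (sm a (wd w))"
    "\<And>f g. P f \<Longrightarrow> P g \<Longrightarrow> P (f + g)"
  shows "P f"
  by (rule free_alg_induct) (use assms in \<open>auto simp: homog_def\<close>)

text \<open>The additive map with prescribed values on the monomials \<open>sm a (wd w)\<close>. The
  value may depend on the coefficient in any additive way, since brackets differentiate coefficients
  and are not \<open>A\<close>-linear.\<close>

definition lin :: "('g list \<Rightarrow> 'a \<Rightarrow> 'b::ab_group_add) \<Rightarrow> ('g, 'a::comm_ring_1) free_alg \<Rightarrow> 'b" where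
  "lin h f = (\<Sum>w\<in>Poly_Mapping.keys f. h w (Poly_Mapping.lookup f w))"

lemma lin_sm_wd:
  assumes "additive (h w)" shows "lin h (sm a (wd w)) = h w a"
  using additive.zero [OF assms] by (simp add: sm_wd lin_def)

lemma additive_lin:
  assumes "\<And>w. additive (h w)" shows "additive (lin h)"
proof
  fix f g :: "('a, 'b) free_alg"
  \<comment> \<open>All three sums are taken over one common finite set of words; words outside a
    support contribute \<open>h w 0 = 0\<close>.\<close>
  have *: "lin h k = (\<Sum>w\<in>Poly_Mapping.keys f \<union> Poly_Mapping.keys g. h w (Poly_Mapping.lookup k w))" if "Poly_Mapping.keys k \<subseteq> Poly_Mapping.keys f \<union> Poly_Mapping.keys g" for k
    unfolding lin_def using that
    by (intro sum.mono_neutral_left) (auto simp: in_keys_iff additive.zero [OF assms])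
  show "lin h (f + g) = lin h f + lin h g"
    by (simp add: * keys_add lookup_add additive.add [OF assms] sum.distrib)
qed

text \<open>Positions are counted from 0 here, in contrast to \<^const>\<open>omit\<close>.\<close>
definition om :: "nat \<Rightarrow> 'g list \<Rightarrow> 'g list" where
  "om i w = take i w @ drop (Suc i) w"

lemma om_append_left [simp]: "i < length w \<Longrightarrow> om i (w @ v) = om i w @ v"
  by (simp add: om_def)

lemma om_append_right [simp]: "om (length w + i) (w @ v) = w @ om i v"
  by (simp add: om_def)

lemma length_om: "i < length w \<Longrightarrow> int (length (om i w)) = int (length w) - 1"
  by (simp add: om_def)

text \<open>The letter at position \<open>j\<close> is moved to the front, past \<open>j\<close>
  letters, and there replaced by its image. The image itself is never moved, so its degree does not
  enter the sign.\<close>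

definition insertion_sum :: "('g \<Rightarrow> ('g, 'a::comm_ring_1) free_alg) \<Rightarrow> 'g list \<Rightarrow> ('g, 'a) free_alg" where
  "insertion_sum m w = (\<Sum>j<length w. sm (sg (int j)) (m (w ! j) * wd (om j w)))"

lemma sum_lessThan_add:
  fixes f :: "nat \<Rightarrow> 'b::comm_monoid_add"
  shows "(\<Sum>j<a + b. f j) = (\<Sum>j<a. f j) + (\<Sum>j<b. f (a + j))"
  by (induction b) (simp_all add: add.assoc)

lemma insertion_sum_append:
  "insertion_sum m (w @ v) = insertion_sum m w * wd v +
     (\<Sum>j<length v. sm (sg (int (length w) + int j)) (m (v ! j) * wd (w @ om j v)))"
  by (simp add: insertion_sum_def sum_lessThan_add sum_distrib_right nth_append mult.assoc)

text \<open>Isolates the contribution of one letter. Each defining relation of the exterior algebra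
  changes one letter or repeats one, so this splitting is what the compatibility checks use.\<close>

lemma insertion_sum_middle:
  "insertion_sum m (w @ x # v) = insertion_sum m w * wd (x # v) + sm (sg (int (length w))) (m x * wd (w @ v))
    + (\<Sum>j<length v. sm (sg (int (length w) + int j + 1)) (m (v ! j) * wd (w @ x # om j v)))"
proof -
  have "om (Suc j) (x # v) = x # om j v" "om 0 (x # v) = v" for j
    by (simp_all add: om_def)
  then show ?thesis
    by (simp add: insertion_sum_append sum.lessThan_Suc_shift ac_simps del: sum.lessThan_Suc)
qed

text \<open>The rule \<open>D (a w) = n a w + a D w\<close>, with \<open>n\<close> prescribing the
  values on coefficients and \<open>m\<close> those on letters.\<close>

definition antider :: "('a \<Rightarrow> ('g, 'a) free_alg) \<Rightarrow> ('g \<Rightarrow> ('g, 'a) free_alg) \<Rightarrow>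
    ('g, 'a::comm_ring_1) free_alg \<Rightarrow> ('g, 'a) free_alg" where
  "antider n m = lin (\<lambda>w a. n a * wd w + sm a (insertion_sum m w))"

lemma additive_antider_aux:
  "additive n \<Longrightarrow> additive (\<lambda>a. n a * wd w + sm a (insertion_sum m w))"
  by (simp add: additive_def sm_add_left algebra_simps)

lemma antider_sm_wd:
  "additive n \<Longrightarrow> antider n m (sm a (wd w)) = n a * wd w + sm a (insertion_sum m w)"
  unfolding antider_def by (rule lin_sm_wd) (rule additive_antider_aux)

lemma additive_antider: "additive n \<Longrightarrow> additive (antider n m)"
  unfolding antider_def by (rule additive_lin) (rule additive_antider_aux)

lemma antider_wd: "additive n \<Longrightarrow> antider n m (wd w) = n 1 * wd w + insertion_sum m w"
  using antider_sm_wd [of n m 1 w] by simp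

text \<open>Dependence on the data is linear already in the free algebra. As the data of the bracket
  are built from its first argument, linearity in that argument comes from here.\<close>

lemma antider_lincomb:
  assumes "additive n" "additive n1" "additive n2"
    and n: "\<And>b. n b = sm c1 (n1 b) + sm c2 (n2 b)" and m: "\<And>x. m x = sm c1 (m1 x) + sm c2 (m2 x)"
  shows "antider n m f = sm c1 (antider n1 m1 f) + sm c2 (antider n2 m2 f)"
proof (induction f rule: free_alg_induct)
  case (mono a w)
  show ?case
    unfolding antider_sm_wd [OF assms(1)] antider_sm_wd [OF assms(2)] antider_sm_wd [OF assms(3)]
    by (simp add: n m insertion_sum_def sm_add sm_sum distrib_right sum.distrib ac_simps)
next
  case (add f g)
  then show ?case
    by (simp add: assms(1-3) additive.add [OF additive_antider] sm_add ac_simps)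
qed (simp add: assms(1-3) additive.zero [OF additive_antider])

text \<open>The grading involution. It allows a sign that depends on the degree to be written down
  for inhomogeneous elements too.\<close>

definition parity :: "('g, 'a::comm_ring_1) free_alg \<Rightarrow> ('g, 'a) free_alg" where
  "parity = lin (\<lambda>w a. sm (sg (int (length w)) * a) (wd w))"

lemma parity_sm_wd: "parity (sm a (wd w)) = sm (sg (int (length w)) * a) (wd w)"
  unfolding parity_def by (rule lin_sm_wd) (simp add: additive_def sm_add_left algebra_simps)

lemma additive_parity: "additive parity"
  unfolding parity_def by (rule additive_lin) (simp add: additive_def sm_add_left algebra_simps)

lemma parity_mult: "parity (f * g) = parity f * parity g"
proof (induction f rule: free_alg_induct)
  case (mono a w)
  show ?case
  proof (induction g rule: free_alg_induct)
    case (mono b v)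
    then show ?case
      by (simp add: parity_sm_wd) (simp add: algebra_simps)
  qed (simp_all add: additive.zero [OF additive_parity] additive.add [OF additive_parity] algebra_simps)
qed (simp_all add: additive.zero [OF additive_parity] additive.add [OF additive_parity] algebra_simps)

lemma parity_homog: "homog d f \<Longrightarrow> parity f = sm (sg d) f"
  by (induction f rule: homog_induct)
    (auto simp: parity_sm_wd sm_add additive.zero [OF additive_parity] additive.add [OF additive_parity])

text \<open>A coefficient is replaced by an element of degree \<open>d\<close> and a letter by one
  of degree \<open>d + 1\<close>, so either kind of term shifts the degree by
  \<open>d\<close>.\<close>

lemma homog_antider:
  assumes "additive n" "\<And>a. homog d (n a)" "\<And>x. homog (d + 1) (m x)" "homog r f"
  shows "homog (r + d) (antider n m f)"
  using assms(4)
proof (induction f rule: homog_induct)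
  case (mono a w)
  have "homog (r + d) (n a * wd w)"
    using homog_mult [OF assms(2) [of a], of r "wd w"] mono by (simp add: add.commute)
  moreover have "homog (r + d) (m (w ! j) * wd (om j w))" if "j < length w" for j
    using homog_mult [OF assms(3), of "r - 1" "wd (om j w)"] mono that
    by (simp add: add.commute length_om)
  ultimately show ?case
    unfolding antider_sm_wd [OF assms(1)] insertion_sum_def
    by (intro homog_add homog_sum homog_sm) auto
next
qed (auto simp: additive.zero [OF additive_antider [OF assms(1)]]
    additive.add [OF additive_antider [OF assms(1)]] intro: homog_add)

section \<open>Congruence modulo the exterior ideal\<close>

lemma ring_of_type_algebra_ring: "ring (ring_of_type_algebra :: 'r::ring_1 ring)"
proof -
  have "\<exists>y. x + y = 0" for x :: 'r
    using add.right_inverse by blast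
  then show ?thesis
    unfolding ring_of_type_algebra_def using add.right_inverse
    by unfold_locales (auto simp: algebra_simps Units_def)
qed

lemma ring_of_type_algebra_simps:
  "carrier ring_of_type_algebra = UNIV" "monoid.mult ring_of_type_algebra = (*)"
  "monoid.one ring_of_type_algebra = 1" "ring.zero ring_of_type_algebra = 0"
  "add ring_of_type_algebra = (+)"
  by (simp_all add: ring_of_type_algebra_def fun_eq_iff)

lemma a_inv_ring_of_type_algebra: "\<ominus>\<^bsub>ring_of_type_algebra\<^esub> x = - (x :: 'r::ring_1)"
  using abelian_group.minus_equality [OF ring.is_abelian_group [OF ring_of_type_algebra_ring], of "- x" x]
  by (simp add: ring_of_type_algebra_simps)

locale exterior =
  fixes scaleA :: "'a::comm_ring_1 \<Rightarrow> 'g::ab_group_add \<Rightarrow> 'g"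
begin

abbreviation I :: "('g, 'a) free_alg set" where
  "I \<equiv> exterior_ideal scaleA"

lemma ideal_I: "ideal I ring_of_type_algebra"
  unfolding exterior_ideal_def
  by (rule ring.genideal_ideal [OF ring_of_type_algebra_ring]) (simp add: ring_of_type_algebra_simps)

sublocale I: ideal I ring_of_type_algebra
  by (rule ideal_I)

lemma I_zero: "0 \<in> I"
  using additive_subgroup.zero_closed [OF I.is_additive_subgroup] by (simp add: ring_of_type_algebra_simps)

lemma I_add: "f \<in> I \<Longrightarrow> g \<in> I \<Longrightarrow> f + g \<in> I"
  using additive_subgroup.a_closed [OF I.is_additive_subgroup] by (simp add: ring_of_type_algebra_simps)

lemma I_mult_left: "f \<in> I \<Longrightarrow> g * f \<in> I"
  using I.I_l_closed by (simp add: ring_of_type_algebra_simps)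

lemma I_mult_right: "f \<in> I \<Longrightarrow> f * g \<in> I"
  using I.I_r_closed by (simp add: ring_of_type_algebra_simps)

lemma I_minus: "f \<in> I \<Longrightarrow> - f \<in> I"
  using I_mult_left [of f "- 1"] by simp

lemma relations_subset: "exterior_relations scaleA \<subseteq> I"
  unfolding exterior_ideal_def
  by (rule ring.genideal_self [OF ring_of_type_algebra_ring]) (simp add: ring_of_type_algebra_simps)

text \<open>Minimality of the generated ideal. Closure under sums and two-sided multiples suffices:
  negatives are multiples by \<open>- 1\<close>, and zero is a multiple of any relation, of which
  there is always one.\<close>

lemma I_subset:
  assumes "\<And>f g. f \<in> J \<Longrightarrow> g \<in> J \<Longrightarrow> f + g \<in> J" "\<And>f g. f \<in> J \<Longrightarrow> g * f \<in> J" "\<And>f g. f \<in> J \<Longrightarrow> f * g \<in> J"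
    and rels: "exterior_relations scaleA \<subseteq> J"
  shows "I \<subseteq> J"
proof -
  have "letter 0 * letter 0 \<in> exterior_relations scaleA"
    by (auto simp: exterior_relations_def)
  then have zero: "0 \<in> J"
    using assms(2) [of "letter 0 * letter 0" 0] rels by auto
  have minus: "- f \<in> J" if "f \<in> J" for f
    using assms(2) [OF that, of "- 1"] by simp
  have inv: "inv\<^bsub>\<lparr>carrier = UNIV, monoid.mult = (+), one = 0\<rparr>\<^esub> f = - f" for f :: "('g, 'a) free_alg"
    using a_inv_ring_of_type_algebra [of f] by (simp add: a_inv_def ring_of_type_algebra_simps)
  have "ideal J ring_of_type_algebra"
    using ring_of_type_algebra_ring assms zero minus
    by (intro idealI)
      (auto simp: ring_of_type_algebra_simps inv intro!: subgroup.intro)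
  then show ?thesis
    unfolding exterior_ideal_def by (rule ring.genideal_minimal [OF ring_of_type_algebra_ring _ rels])
qed

text \<open>Computations take place on representatives in the free algebra; only at the end are
  congruences translated into equalities of cosets.\<close>

definition cong :: "('g, 'a) free_alg \<Rightarrow> ('g, 'a) free_alg \<Rightarrow> bool" (infix \<open>\<approx>\<close> 50) where
  "f \<approx> g \<longleftrightarrow> f - g \<in> I"

lemma cong_refl [simp, intro!]: "f \<approx> f"
  by (simp add: cong_def I_zero)

lemma cong_sym: "f \<approx> g \<Longrightarrow> g \<approx> f"
  using I_minus [of "f - g"] by (simp add: cong_def)

lemma cong_trans [trans]: "f \<approx> g \<Longrightarrow> g \<approx> h \<Longrightarrow> f \<approx> h"
  using I_add [of "f - g" "g - h"] by (simp add: cong_def)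

lemma eq_cong_trans [trans]: "f = g \<Longrightarrow> g \<approx> h \<Longrightarrow> f \<approx> h"
  by simp

lemma cong_eq_trans [trans]: "f \<approx> g \<Longrightarrow> g = h \<Longrightarrow> f \<approx> h"
  by simp

lemma cong_add: "f \<approx> g \<Longrightarrow> f' \<approx> g' \<Longrightarrow> f + f' \<approx> g + g'"
  using I_add [of "f - g" "f' - g'"] by (simp add: cong_def algebra_simps)

lemma cong_minus: "f \<approx> g \<Longrightarrow> - f \<approx> - g"
  using I_minus [of "f - g"] by (simp add: cong_def algebra_simps)

lemma cong_diff: "f \<approx> g \<Longrightarrow> f' \<approx> g' \<Longrightarrow> f - f' \<approx> g - g'"
  using cong_add [of f g "- f'" "- g'"] cong_minus by simp

lemma cong_mult: "f \<approx> g \<Longrightarrow> f' \<approx> g' \<Longrightarrow> f * f' \<approx> g * g'"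
  using I_add [OF I_mult_right [of "f - g" f'] I_mult_left [of "f' - g'" g]]
  by (simp add: cong_def algebra_simps)

lemma cong_sm: "f \<approx> g \<Longrightarrow> sm a f \<approx> sm a g"
  by (simp add: sm_def cong_mult)

lemma cong_sum: "(\<And>i. i \<in> S \<Longrightarrow> f i \<approx> g i) \<Longrightarrow> sum f S \<approx> sum g S"
  by (induction S rule: infinite_finite_induct) (auto intro: cong_add)

lemmas cong_intros = cong_add cong_minus cong_diff cong_mult cong_sm cong_sum

lemma cong_0_iff: "f \<approx> 0 \<longleftrightarrow> f \<in> I"
  by (simp add: cong_def)

lemma wd_middle_cong: "f \<approx> g \<Longrightarrow> wd u * f * wd v \<approx> wd u * g * wd v"
  by (intro cong_intros) auto

section \<open>Multilinearity and alternation of words\<close>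

lemma wd_add: "wd (u @ (x + y) # v) \<approx> wd (u @ x # v) + wd (u @ y # v)"
proof -
  have "letter (x + y) - letter x - letter y \<in> I"
    using relations_subset unfolding exterior_relations_def by blast
  then have "letter (x + y) \<approx> letter x + letter y"
    by (simp add: cong_def algebra_simps)
  from wd_middle_cong [OF this, of u v] show ?thesis
    by (simp add: algebra_simps)
qed

lemma wd_scale: "wd (u @ scaleA a x # v) \<approx> sm a (wd (u @ x # v))"
proof -
  have "letter (scaleA a x) - const_alg a * letter x \<in> I"
    using relations_subset unfolding exterior_relations_def by blast
  then have "letter (scaleA a x) \<approx> sm a (letter x)"
    by (simp add: cong_def sm_def)
  from wd_middle_cong [OF this, of u v] show ?thesis by simp
qed

lemma wd_alt: "wd (u @ x # x # v) \<approx> 0"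
proof -
  have "letter x * letter x \<in> I"
    using relations_subset unfolding exterior_relations_def by blast
  then have "letter x * letter x \<approx> 0"
    by (simp add: cong_def)
  from wd_middle_cong [OF this, of u v] show ?thesis by simp
qed

lemma letter_add: "wd [x + y] \<approx> wd [x] + wd [y]"
  using wd_add [of "[]" x y "[]"] by simp

lemma letter_scale: "wd [scaleA a x] \<approx> sm a (wd [x])"
  using wd_scale [of "[]" a x "[]"] by simp

text \<open>Polarization: expand the vanishing word that contains \<open>x + y\<close> twice in
  succession.\<close>

lemma wd_swap: "wd (u @ x # y # v) \<approx> - wd (u @ y # x # v)"
proof -
  have "0 \<approx> wd (u @ (x + y) # (x + y) # v)"
    by (rule cong_sym) (rule wd_alt)
  also have "\<dots> \<approx> wd (u @ x # (x + y) # v) + wd (u @ y # (x + y) # v)"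
    by (rule wd_add)
  also have "\<dots> \<approx> (wd ((u @ [x]) @ x # v) + wd ((u @ [x]) @ y # v))
      + (wd ((u @ [y]) @ x # v) + wd ((u @ [y]) @ y # v))"
    using wd_add [of "u @ [x]" x y v] wd_add [of "u @ [y]" x y v]
    by (intro cong_add) simp_all
  also have "\<dots> \<approx> (0 + wd (u @ x # y # v)) + (wd (u @ y # x # v) + 0)"
    using wd_alt [of u x v] wd_alt [of u y v] by (intro cong_add) simp_all
  finally have "wd (u @ x # y # v) + wd (u @ y # x # v) \<approx> 0"
    by (simp add: cong_sym)
  then show ?thesis
    by (simp add: cong_def)
qed

section \<open>Graded commutativity\<close>

lemma letter_wd_comm: "wd (u @ x # w) \<approx> sm (sg (int (length w))) (wd (u @ w @ [x]))"
proof (induction w arbitrary: u)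
  case (Cons y w)
  have "wd (u @ x # y # w) \<approx> - wd ((u @ [y]) @ x # w)"
    using wd_swap by simp
  also have "\<dots> \<approx> - sm (sg (int (length w))) (wd ((u @ [y]) @ w @ [x]))"
    by (intro cong_minus Cons.IH)
  finally show ?case
    by (simp add: minus_sm minus_sg add.commute)
qed simp

text \<open>The first letter \<open>x\<close> is moved to the far end, past \<open>w\<close> and
  \<open>v\<close>; then \<open>w\<close> is moved past \<open>v @ [x]\<close>. The letter
  \<open>x\<close> and the word \<open>w\<close> pass each other twice, so these two signs cancel.
  The induction needs \<open>v\<close> arbitrary because \<open>x\<close> is appended to it.\<close>

lemma wd_comm: "wd (w @ v) \<approx> sm (sg (int (length w) * int (length v))) (wd (v @ w))"
proof (induction w arbitrary: v)
  case (Cons x w)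
  have "wd ((x # w) @ v) \<approx> sm (sg (int (length (w @ v)))) (wd (w @ v @ [x]))"
    using letter_wd_comm [of "[]" x "w @ v"] by simp
  also have "\<dots> \<approx> sm (sg (int (length (w @ v))))
      (sm (sg (int (length w) * int (length (v @ [x])))) (wd ((v @ [x]) @ w)))"
    by (intro cong_sm Cons.IH)
  also have "\<dots> = sm (sg (int (length (x # w)) * int (length v))) (wd (v @ x # w))"
    by (simp add: algebra_simps) (rule arg_cong [of _ _ "\<lambda>c. sm c _"], auto intro!: sg_eqI)
  finally show ?case .
qed simp

lemma homog_comm:
  assumes "homog p f" "homog q g" shows "f * g \<approx> sm (sg (p * q)) (g * f)"
  using assms(1)
proof (induction f rule: homog_induct)
  case (mono a w)
  from assms(2) show ?case
  proof (induction g rule: homog_induct)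
    case (mono b v)
    show ?case
      using cong_sm [OF wd_comm [of w v], of "b * a"] \<open>int (length w) = p\<close> \<open>int (length v) = q\<close>
      by (simp add: algebra_simps)
  next
    case (add f g)
    then show ?case using cong_add [OF add] by (simp add: algebra_simps sm_add)
  qed simp
next
  case (add f g)
  then show ?case using cong_add [OF add] by (simp add: algebra_simps sm_add)
qed simp

text \<open>The ideal is generated by homogeneous elements: the involution multiplies every relation
  by a scalar, and it is multiplicative.\<close>

lemma parity_I: "f \<in> I \<Longrightarrow> parity f \<in> I"
proof -
  have "I \<subseteq> {f. parity f \<in> I}"
  proof (rule I_subset)
    have letter: "parity (sm a (letter x)) = sm (sg 1) (sm a (letter x :: ('g, 'a) free_alg))" for a x
      by (simp add: parity_sm_wd)
    have scalar: "\<exists>c. parity r = sm c r" if "r \<in> exterior_relations scaleA" for r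
    proof -
      from that consider x y where "r = letter (x + y) - letter x - letter y"
        | a x where "r = letter (scaleA a x) - sm a (letter x)" | x where "r = letter x * letter x"
        by (auto simp: exterior_relations_def sm_def)
      then show ?thesis
      proof cases
        case 1
        then have "parity r = sm (sg 1) r"
          using letter [of 1] by (simp add: additive.diff [OF additive_parity] sm_diff)
        then show ?thesis ..
      next
        case 2
        then have "parity r = sm (sg 1) r"
          using letter [of 1] letter [of a] by (simp add: additive.diff [OF additive_parity] sm_diff)
        then show ?thesis ..
      next
        case 3
        then show ?thesis
          using parity_sm_wd [of 1 "[x, x]"] by auto
      qed
    qed
    show "exterior_relations scaleA \<subseteq> {f. parity f \<in> I}"
    proof
      fix r assume r: "r \<in> exterior_relations scaleA"
      then obtain c where "parity r = sm c r"
        using scalar by blast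
      moreover have "sm c r \<in> I"
        unfolding sm_def using r relations_subset by (intro I_mult_left) blast
      ultimately show "r \<in> {f. parity f \<in> I}" by simp
    qed
  qed (auto simp: parity_mult additive.add [OF additive_parity] intro: I_add I_mult_left I_mult_right)
  then show "f \<in> I \<Longrightarrow> parity f \<in> I" by blast
qed

text \<open>Here the data vary and the element \<open>f\<close> of the free algebra is fixed.
  Dependence on \<open>f\<close> modulo the ideal is a separate matter, settled by
  \<open>D_cong\<close>.\<close>

lemma antider_cong:
  assumes "additive n" "additive n'" "\<And>b. n b \<approx> n' b" "\<And>x. m x \<approx> m' x"
  shows "antider n m f \<approx> antider n' m' f"
proof (induction f rule: free_alg_induct)
  case (mono a w)
  show ?case
    unfolding antider_sm_wd [OF assms(1)] antider_sm_wd [OF assms(2)] insertion_sum_def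
    by (intro cong_intros assms(3,4) cong_refl)
next
  case (add f g)
  then show ?case
    using cong_add by (simp add: assms(1,2) additive.add [OF additive_antider])
qed (simp add: assms(1,2) additive.zero [OF additive_antider])

end

section \<open>Twisted derivations\<close>

text \<open>The data of \<open>[P, .]\<close> on \<open>A\<close> and on \<open>G\<close>.
  Additivity of \<open>n\<close> is an equality because the evaluation of \<open>antider\<close> on
  monomials rests on it; the other conditions are congruences, as the Leibniz rule for
  \<open>scaleA a x\<close> already uses the relations of the exterior algebra.\<close>

locale twisted_derivation = exterior scaleA
  for scaleA :: "'a::comm_ring_1 \<Rightarrow> 'g::ab_group_add \<Rightarrow> 'g" +
  fixes n :: "'a \<Rightarrow> ('g, 'a) free_alg" and m :: "'g \<Rightarrow> ('g, 'a) free_alg"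
  assumes additive_n: "additive n"
    and n_mult: "n (a * b) \<approx> sm b (n a) + sm a (n b)"
    and m_add: "m (x + y) \<approx> m x + m y"
    and m_scale: "m (scaleA a x) \<approx> n a * wd [x] + sm a (m x)"
begin

abbreviation D :: "('g, 'a) free_alg \<Rightarrow> ('g, 'a) free_alg" where
  "D \<equiv> antider n m"

lemmas D_sm_wd = antider_sm_wd [OF additive_n]
lemmas additive_D = additive_antider [OF additive_n]
lemmas D_simps = additive.zero [OF additive_D] additive.add [OF additive_D] additive.minus [OF additive_D]
  additive.diff [OF additive_D]

lemma n_1: "n 1 \<approx> 0"
  using n_mult [of 1 1] I_minus [of "- n 1"] by (simp add: cong_def)

lemma D_wd: "D (wd w) \<approx> insertion_sum m w"
proof -
  have "D (wd w) \<approx> 0 * wd w + insertion_sum m w"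
    unfolding antider_wd [OF additive_n] by (intro cong_intros n_1 cong_refl)
  then show ?thesis by simp
qed

lemma D_sm: "D (sm a f) \<approx> n a * f + sm a (D f)"
proof (induction f rule: free_alg_induct)
  case (mono b w)
  have "D (sm a (sm b (wd w))) \<approx> (sm b (n a) + sm a (n b)) * wd w + sm (a * b) (insertion_sum m w)"
    by (simp add: D_sm_wd) (intro cong_intros n_mult cong_refl)
  then show ?case
    by (simp add: D_sm_wd sm_add distrib_right ac_simps)
next
  case (add f g)
  then show ?case
    using cong_add [OF add] by (simp add: D_simps sm_add algebra_simps)
qed (simp add: D_simps)

section \<open>Compatibility with the defining relations\<close>

lemma insertion_sum_add:
  "insertion_sum m (w @ (x + y) # v) \<approx> insertion_sum m (w @ x # v) + insertion_sum m (w @ y # v)"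
proof -
  have "insertion_sum m (w @ (x + y) # v) \<approx>
      insertion_sum m w * (wd (x # v) + wd (y # v)) + sm (sg (int (length w))) ((m x + m y) * wd (w @ v))
      + (\<Sum>j<length v. sm (sg (int (length w) + int j + 1)) (m (v ! j) * (wd (w @ x # om j v) + wd (w @ y # om j v))))"
    unfolding insertion_sum_middle
    by (intro cong_intros m_add wd_add wd_add [of "[]", simplified] cong_refl)
  then show ?thesis
    by (simp add: insertion_sum_middle sm_add distrib_left distrib_right sum.distrib ac_simps)
qed

text \<open>The scaled letter produces an extra term in which \<open>n a\<close> and
  \<open>x\<close> stand at the front with the sign of the position. Moving \<open>x\<close> back to
  its place cancels that sign and leaves \<open>n a\<close> times the whole word.\<close>

lemma insertion_sum_scale:
  "insertion_sum m (w @ scaleA a x # v) \<approx> n a * wd (w @ x # v) + sm a (insertion_sum m (w @ x # v))"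
proof -
  have *: "sm (sg (int (length w))) (wd (x # w @ v)) \<approx> wd (w @ x # v)"
    using cong_sm [OF cong_mult [OF letter_wd_comm [of "[]" x w] cong_refl [of "wd v"]], of "sg (int (length w))"]
    by simp (simp add: sg_def)
  have "insertion_sum m (w @ scaleA a x # v) \<approx>
      insertion_sum m w * sm a (wd (x # v))
      + sm (sg (int (length w))) ((n a * wd [x] + sm a (m x)) * wd (w @ v))
      + (\<Sum>j<length v. sm (sg (int (length w) + int j + 1)) (m (v ! j) * sm a (wd (w @ x # om j v))))"
    unfolding insertion_sum_middle
    by (intro cong_intros m_scale wd_scale wd_scale [of "[]", simplified] cong_refl)
  also have "\<dots> = n a * sm (sg (int (length w))) (wd (x # w @ v)) + sm a (insertion_sum m (w @ x # v))"
    by (simp add: insertion_sum_middle sm_add distrib_left distrib_right sm_sum ac_simps)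
  also have "\<dots> \<approx> n a * wd (w @ x # v) + sm a (insertion_sum m (w @ x # v))"
    by (intro cong_intros * cong_refl)
  finally show ?thesis .
qed

text \<open>The two terms that replace one of the equal letters have opposite signs, their positions
  being adjacent. All other terms still contain the repeated letter.\<close>

lemma insertion_sum_alt: "insertion_sum m (w @ x # x # v) \<approx> 0"
proof -
  have "insertion_sum m (w @ x # x # v) =
      insertion_sum m w * wd (x # x # v)
      + (\<Sum>j<length v. sm (sg (int (length w) + int j + 2)) (m (v ! j) * wd (w @ x # x # om j v)))
      + (sm (sg (int (length w))) (m x * wd (w @ x # v)) + sm (sg (int (length w) + 1)) (m x * wd (w @ x # v)))"
    using insertion_sum_middle [of m "w @ [x]" x v] insertion_sum_middle [of m w x "[]"]
    by (simp add: algebra_simps)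
  also have "\<dots> = insertion_sum m w * wd (x # x # v)
      + (\<Sum>j<length v. sm (sg (int (length w) + int j + 2)) (m (v ! j) * wd (w @ x # x # om j v)))"
    by (simp add: sm_add_left [symmetric] sg_shift)
  also have "\<dots> \<approx> insertion_sum m w * 0
      + (\<Sum>j<length v. sm (sg (int (length w) + int j + 2)) (m (v ! j) * 0))"
    by (intro cong_intros wd_alt wd_alt [of "[]", simplified] cong_refl)
  finally show ?thesis by simp
qed

lemma D_relation:
  assumes "r \<in> exterior_relations scaleA" shows "D (f * r * g) \<approx> 0"
proof -
  have r: "r \<approx> 0"
    using assms relations_subset by (auto simp: cong_0_iff)
  have *: "D (wd w * r * wd v) \<approx> 0" for w v
  proof -
    from assms consider x y where "r = letter (x + y) - letter x - letter y"
      | a x where "r = letter (scaleA a x) - sm a (letter x)" | x where "r = letter x * letter x"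
      by (auto simp: exterior_relations_def sm_def)
    then show ?thesis
    proof cases
      case 1
      have "D (wd w * r * wd v) = D (wd (w @ (x + y) # v)) - D (wd (w @ x # v)) - D (wd (w @ y # v))"
        by (simp add: 1 algebra_simps D_simps)
      also have "\<dots> \<approx> insertion_sum m (w @ (x + y) # v) - insertion_sum m (w @ x # v) - insertion_sum m (w @ y # v)"
        by (intro cong_intros D_wd)
      also have "\<dots> \<approx> 0"
        using insertion_sum_add [of w x y v] by (simp add: cong_def algebra_simps)
      finally show ?thesis .
    next
      case 2
      have "D (wd w * r * wd v) = D (wd (w @ scaleA a x # v)) - D (sm a (wd (w @ x # v)))"
        by (simp add: 2 algebra_simps D_simps)
      also have "\<dots> \<approx> insertion_sum m (w @ scaleA a x # v)
          - (n a * wd (w @ x # v) + sm a (D (wd (w @ x # v))))"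
        by (intro cong_intros D_wd D_sm)
      also have "\<dots> \<approx> insertion_sum m (w @ scaleA a x # v)
          - (n a * wd (w @ x # v) + sm a (insertion_sum m (w @ x # v)))"
        by (intro cong_intros D_wd cong_refl)
      also have "\<dots> \<approx> 0"
        using insertion_sum_scale [of w a x v] by (simp add: cong_def)
      finally show ?thesis .
    next
      case 3
      have "D (wd w * r * wd v) = D (wd (w @ x # x # v))"
        by (simp add: 3)
      also have "\<dots> \<approx> insertion_sum m (w @ x # x # v)" by (rule D_wd)
      also have "\<dots> \<approx> 0" by (rule insertion_sum_alt)
      finally show ?thesis .
    qed
  qed
  show ?thesis
  proof (induction f rule: free_alg_induct)
    case (mono a w)
    show ?case
    proof (induction g rule: free_alg_induct)
      case (mono b v)
      have "D (sm a (wd w) * r * sm b (wd v)) = D (sm (b * a) (wd w * r * wd v))"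
        by simp
      \<comment> \<open>Differentiating the outer coefficient leaves a multiple of \<open>r\<close>,
        which vanishes since \<open>r\<close> itself lies in the ideal.\<close>
      also have "\<dots> \<approx> n (b * a) * (wd w * r * wd v) + sm (b * a) (D (wd w * r * wd v))"
        by (rule D_sm)
      also have "\<dots> \<approx> n (b * a) * (wd w * 0 * wd v) + sm (b * a) 0"
        by (intro cong_intros r * cong_refl)
      finally show ?case by simp
    next
      case (add f g)
      then show ?case using cong_add [OF add] by (simp add: algebra_simps D_simps)
    qed (simp add: D_simps)
  next
    case (add f g)
    then show ?case using cong_add [OF add] by (simp add: algebra_simps D_simps)
  qed (simp add: D_simps)
qed

text \<open>The elements that \<open>D\<close> sends into the ideal do not visibly form an ideal.
  Quantifying over all left and right factors gives a set closed under multiplication by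
  construction, to which minimality applies.\<close>

lemma D_I: "f \<in> I \<Longrightarrow> D f \<in> I"
proof -
  have "I \<subseteq> {f. \<forall>u v. D (u * f * v) \<in> I}"
  proof (rule I_subset)
    show "exterior_relations scaleA \<subseteq> {f. \<forall>u v. D (u * f * v) \<in> I}"
      using D_relation by (auto simp: cong_0_iff)
  next
    fix f g
    assume f: "f \<in> {f. \<forall>u v. D (u * f * v) \<in> I}"
    have "D (u * (g * f) * v) \<in> I" for u v
      using f [simplified, rule_format, of "u * g" v] by (simp add: mult.assoc)
    then show "g * f \<in> {f. \<forall>u v. D (u * f * v) \<in> I}" by simp
    have "D (u * (f * g) * v) \<in> I" for u v
      using f [simplified, rule_format, of u "g * v"] by (simp add: mult.assoc)
    then show "f * g \<in> {f. \<forall>u v. D (u * f * v) \<in> I}" by simp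
  qed (auto simp: distrib_left distrib_right D_simps intro: I_add)
  then have "\<forall>u v. D (u * f * v) \<in> I" if "f \<in> I" for f
    using that by blast
  from this [rule_format, of f 1 1] show "f \<in> I \<Longrightarrow> D f \<in> I"
    by simp
qed

lemma D_cong: "f \<approx> g \<Longrightarrow> D f \<approx> D g"
  using D_I [of "f - g"] by (simp add: cong_def D_simps)

text \<open>In a term that differentiates a letter of \<open>v\<close>, the word \<open>w\<close> is
  moved to the right past the remaining \<open>length v - 1\<close> letters. Together with the sign
  from the shift of positions by \<open>length w\<close>, this gives the exponent
  \<open>length w * length v\<close>.\<close>

lemma insertion_sum_append_cong:
  "insertion_sum m (w @ v) \<approx> insertion_sum m w * wd v
     + sm (sg (int (length w) * int (length v))) (insertion_sum m v * wd w)"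
proof -
  have *: "sm (sg (int (length w) + int j)) (wd (w @ om j v)) \<approx>
      sm (sg (int (length w) * int (length v) + int j)) (wd (om j v @ w))" if "j < length v" for j
  proof -
    have "sm (sg (int (length w) + int j)) (wd (w @ om j v)) \<approx> sm (sg (int (length w) + int j))
        (sm (sg (int (length w) * int (length (om j v)))) (wd (om j v @ w)))"
      by (intro cong_sm wd_comm)
    also have "\<dots> = sm (sg (int (length w) * int (length v) + int j)) (wd (om j v @ w))"
      by (simp add: length_om that algebra_simps)
    finally show ?thesis .
  qed
  have "insertion_sum m (w @ v) = insertion_sum m w * wd v
      + (\<Sum>j<length v. m (v ! j) * sm (sg (int (length w) + int j)) (wd (w @ om j v)))"
    by (simp add: insertion_sum_append)
  also have "\<dots> \<approx> insertion_sum m w * wd v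
      + (\<Sum>j<length v. m (v ! j) * sm (sg (int (length w) * int (length v) + int j)) (wd (om j v @ w)))"
    by (intro cong_intros cong_refl *) simp
  finally show ?thesis
    by (simp add: insertion_sum_def sm_sum sum_distrib_right mult.assoc)
qed

text \<open>A Leibniz rule with the differentiated factor always on the left, so that only the
  degrees of \<open>f\<close> and \<open>g\<close> occur in the sign.\<close>

lemma D_mult:
  assumes "homog q f" "homog r g"
  shows "D (f * g) \<approx> D f * g + sm (sg (q * r)) (D g * f)"
  using assms(1)
proof (induction f rule: homog_induct)
  case (mono a w)
  from assms(2) show ?case
  proof (induction g rule: homog_induct)
    case (mono b v)
    let ?s = "sg (q * r) :: 'a"
    have *: "wd (w @ v) \<approx> sm ?s (wd (v @ w))"
      using wd_comm [of w v] \<open>int (length w) = q\<close> mono by simp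
    have "D (sm a (wd w) * sm b (wd v)) = n (a * b) * wd (w @ v) + sm (a * b) (insertion_sum m (w @ v))"
      by (simp add: D_sm_wd mult.commute)
    also have "\<dots> \<approx> (sm b (n a) + sm a (n b)) * wd (w @ v)
      + sm (a * b) (insertion_sum m w * wd v + sm ?s (insertion_sum m v * wd w))"
      using insertion_sum_append_cong [of w v] \<open>int (length w) = q\<close> mono
      by (intro cong_intros n_mult) simp_all
    also have "\<dots> = sm b (n a) * wd (w @ v) + sm a (n b) * wd (w @ v)
      + sm (a * b) (insertion_sum m w * wd v + sm ?s (insertion_sum m v * wd w))"
      by (simp add: distrib_right)
    \<comment> \<open>The term with \<open>n b\<close> belongs to the derivative of the second
      factor, so \<open>v\<close> has to be brought in front of \<open>w\<close>.\<close>
    also have "\<dots> \<approx> sm b (n a) * wd (w @ v) + sm a (n b) * sm ?s (wd (v @ w))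
      + sm (a * b) (insertion_sum m w * wd v + sm ?s (insertion_sum m v * wd w))"
      by (intro cong_intros * cong_refl)
    also have "\<dots> = D (sm a (wd w)) * sm b (wd v) + sm ?s (D (sm b (wd v)) * sm a (wd w))"
      by (simp add: D_sm_wd sm_add distrib_right mult.assoc) (simp add: ac_simps)
    finally show ?case .
  next
    case (add f g)
    then show ?case using cong_add [OF add] by (simp add: algebra_simps D_simps sm_add)
  qed (simp add: D_simps)
next
  case (add f g)
  then show ?case using cong_add [OF add] by (simp add: algebra_simps D_simps sm_add)
qed (simp add: D_simps)

end

section \<open>The exterior algebra as a quotient\<close>

context exterior
begin

abbreviation E :: "('g, 'a) free_alg set ring" where
  "E \<equiv> exterior_algebra scaleA"

abbreviation cls :: "('g, 'a) free_alg \<Rightarrow> ('g, 'a) free_alg set" where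
  "cls \<equiv> ext_class scaleA"

lemma ring_E: "ring E"
  unfolding exterior_algebra_def by (rule I.quotient_is_ring)

sublocale E: ring E
  by (rule ring_E)

lemma cls_hom: "cls \<in> ring_hom ring_of_type_algebra E"
  unfolding exterior_algebra_def ext_class_def by (rule I.rcos_ring_hom)

lemma carrier_E: "carrier E = range cls"
  by (auto simp: exterior_algebra_def ext_class_def FactRing_simps ring_of_type_algebra_simps A_RCOSETS_def'
    A_RCOSETS_defs a_r_coset_def)

lemma cls_in_carrier [simp]: "cls f \<in> carrier E"
  by (simp add: carrier_E)

lemma cls_mult: "cls f \<otimes>\<^bsub>E\<^esub> cls g = cls (f * g)"
  using ring_hom_mult [OF cls_hom, of f g] by (simp add: ring_of_type_algebra_simps)

lemma cls_add: "cls f \<oplus>\<^bsub>E\<^esub> cls g = cls (f + g)"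
  using ring_hom_add [OF cls_hom, of f g] by (simp add: ring_of_type_algebra_simps)

lemma cls_1: "\<one>\<^bsub>E\<^esub> = cls 1"
  using ring_hom_one [OF cls_hom] by (simp add: ring_of_type_algebra_simps)

lemma cls_0: "\<zero>\<^bsub>E\<^esub> = cls 0"
  using ring_hom_zero [OF cls_hom ring_of_type_algebra_ring ring_E] by (simp add: ring_of_type_algebra_simps)

lemma cls_sum: "finite S \<Longrightarrow> (\<Oplus>\<^bsub>E\<^esub>i\<in>S. cls (f i)) = cls (\<Sum>i\<in>S. f i)"
  by (induction S rule: finite_induct) (simp_all add: cls_0 cls_add E.finsum_insert)

lemma cls_eq_iff: "cls f = cls g \<longleftrightarrow> f \<approx> g"
proof -
  have *: "cls h = {i + h | i. i \<in> I}" for h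
    by (auto simp: ext_class_def a_r_coset_def' ring_of_type_algebra_simps)
  have "f \<in> cls f"
    unfolding * using I_zero by force
  then have "f \<approx> g" if "cls f = cls g"
    unfolding that unfolding * cong_def by auto
  moreover have "cls f \<subseteq> cls g" if "f \<approx> g" for f g
  proof
    fix h assume "h \<in> cls f"
    then obtain i where "h = i + f" "i \<in> I"
      by (auto simp: *)
    moreover have "h = (i + (f - g)) + g"
      by (simp add: \<open>h = i + f\<close>)
    ultimately show "h \<in> cls g"
      unfolding * using that I_add unfolding cong_def by blast
  qed
  ultimately show ?thesis
    using cong_sym by blast
qed

lemma ext_const_cls: "ext_const scaleA a = cls (sm a 1)"
  by (simp add: ext_const_def const_alg_eq_sm)

lemma ext_scale_cls: "ext_scale scaleA a (cls f) = cls (sm a f)"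
  by (simp add: ext_scale_def ext_const_def cls_mult sm_def)

lemma ext_scaleK_cls: "ext_scaleK scaleK scaleA c (cls f) = cls (sm (scaleK c 1) f)"
  by (simp add: ext_scaleK_def ext_scale_cls)

lemma ext_vec_cls: "ext_vec scaleA x = cls (wd [x])"
  by (simp add: ext_vec_def)

lemma wedge_list_cls: "wedge_list scaleA xs = cls (wd xs)"
  by (induction xs) (simp_all add: wedge_list_def cls_1 ext_vec_cls cls_mult)

lemma ext_degree_cls: "ext_degree scaleA p = cls ` {f. homog p f}"
  by (auto simp: ext_degree_def homog_def)

lemma omit_Suc: "omit (Suc i) xs = om i xs"
  by (simp add: omit_def om_def)

text \<open>A coefficient is absorbed into the first letter. Every monomial with a nonempty word is
  thus a decomposable element of the kind on which the bracket is prescribed.\<close>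

lemma cls_generator: "cls (sm a (wd (x # w))) = wedge_list scaleA (scaleA a x # w)"
  using wd_scale [of "[]" a x w] by (simp add: wedge_list_cls cls_eq_iff cong_sym)

end

section \<open>The bracket on the free algebra\<close>

context lie_rinehart
begin

sublocale exterior scaleA .

section \<open>Consequences of the Lie--Rinehart axioms\<close>

lemma lie_add: "lie (x + y) z = lie x z + lie y z" "lie z (x + y) = lie z x + lie z y"
  using L.lie_linear_left [of z] L.lie_linear_right [of z]
  unfolding Vector_Spaces.linear_def module_hom_def module_hom_axioms_def by simp_all

lemma lie_commute: "lie x y = - lie y x"
proof -
  have "lie (x + y) (x + y) = lie x y + lie y x"
    unfolding lie_add by (simp add: L.lie_alternating)
  then show ?thesis
    by (simp add: L.lie_alternating eq_neg_iff_add_eq_0)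
qed

lemma lie_scale_left: "lie (scaleA a x) y = scaleA a (lie x y) - scaleA (anchor y a) x"
  using lie_leibniz [of y a x] lie_commute [of "scaleA a x" y] lie_commute [of x y]
  by simp

lemma anchor_linear:
  "anchor x (a + b) = anchor x a + anchor x b" "anchor x (scaleK c a) = scaleK c (anchor x a)"
  using anchor_derivation [of x]
  unfolding is_derivation_def Vector_Spaces.linear_def module_hom_def module_hom_axioms_def by simp_all

lemma anchor_mult: "anchor x (a * b) = a * anchor x b + anchor x a * b"
  using anchor_derivation [of x] by (simp add: is_derivation_def)

lemma anchor_1: "anchor x 1 = 0"
  using anchor_mult [of x 1 1] by simp

lemma anchor_const: "anchor x (scaleK c 1) = 0"
  by (simp add: anchor_linear anchor_1)

lemma wd_minus: "wd ((- x) # v) \<approx> - wd (x # v)"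
  using wd_scale [of "[]" "- 1" x v] by (simp add: minus_sm [of 1, simplified])

text \<open>The operator \<open>[a, .]\<close>: it vanishes on \<open>A\<close> and is, up to sign,
  contraction with the differential of \<open>a\<close>.\<close>

definition bracket_fun :: "'a \<Rightarrow> ('g, 'a) free_alg \<Rightarrow> ('g, 'a) free_alg" where
  "bracket_fun a = antider (\<lambda>_. 0) (\<lambda>x. sm (- anchor x a) 1)"

text \<open>The operator \<open>[y, .]\<close>, that is, the Lie derivative along
  \<open>y\<close>.\<close>

definition bracket_vec :: "'g \<Rightarrow> ('g, 'a) free_alg \<Rightarrow> ('g, 'a) free_alg" where
  "bracket_vec y = antider (\<lambda>b. sm (anchor y b) 1) (\<lambda>x. wd [lie y x])"

text \<open>
  The values of \<open>[P, \<cdot>]\<close> on \<open>A\<close> and on \<open>G\<close>. The parity operator accounts for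
  \<open>[P, a] = (-1)\<^sup>p [a, P]\<close>.
\<close>

definition ad_fun :: "('g, 'a) free_alg \<Rightarrow> 'a \<Rightarrow> ('g, 'a) free_alg" where
  "ad_fun P a = bracket_fun a (parity P)"

definition ad_vec :: "('g, 'a) free_alg \<Rightarrow> 'g \<Rightarrow> ('g, 'a) free_alg" where
  "ad_vec P y = - bracket_vec y P"

definition bracket :: "('g, 'a) free_alg \<Rightarrow> ('g, 'a) free_alg \<Rightarrow> ('g, 'a) free_alg" where
  "bracket P = antider (ad_fun P) (ad_vec P)"

section \<open>Brackets with elements of degree 0 and 1\<close>

lemma additive_zero: "additive (\<lambda>_. 0)"
  by standard simp

lemma additive_anchor: "additive (\<lambda>b. sm (anchor y b) 1)"
  by standard (simp add: anchor_linear sm_add_left)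

lemma twisted_derivation_fun: "twisted_derivation scaleA (\<lambda>_. 0) (\<lambda>x. sm (- anchor x a) 1)"
  by standard (simp_all add: anchor_add anchor_scale sm_add_left [symmetric])

text \<open>The product rule on \<open>A\<close> is the derivation property of the anchor, and the
  rule for \<open>scaleA a x\<close> is the Leibniz rule of the Lie--Rinehart bracket.\<close>

lemma twisted_derivation_vec: "twisted_derivation scaleA (\<lambda>b. sm (anchor y b) 1) (\<lambda>x. wd [lie y x])"
proof
  fix a x
  have "wd [lie y (scaleA a x)] \<approx> wd [scaleA a (lie y x)] + wd [scaleA (anchor y a) x]"
    unfolding lie_leibniz by (rule letter_add)
  also have "\<dots> \<approx> sm a (wd [lie y x]) + sm (anchor y a) (wd [x])"
    by (intro cong_add letter_scale)
  finally show "wd [lie y (scaleA a x)] \<approx> sm (anchor y a) 1 * wd [x] + sm a (wd [lie y x])"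
    by (simp add: add.commute)
qed (simp_all add: anchor_linear anchor_mult sm_add_left lie_add letter_add mult.commute add.commute)

lemma additive_bracket_fun: "additive (bracket_fun a)"
  unfolding bracket_fun_def by (rule additive_antider [OF additive_zero])

lemma additive_bracket_vec: "additive (bracket_vec y)"
  unfolding bracket_vec_def by (rule additive_antider [OF additive_anchor])

text \<open>Only the derivatives of \<open>a\<close> enter. Stating the hypothesis through the
  anchor covers sums, products and multiples by constants at once.\<close>

lemma bracket_fun_lincomb:
  assumes "\<And>x. anchor x a = c1 * anchor x a1 + c2 * anchor x a2"
  shows "bracket_fun a f = sm c1 (bracket_fun a1 f) + sm c2 (bracket_fun a2 f)"
  unfolding bracket_fun_def
  by (rule antider_lincomb) (simp_all add: additive_zero assms sm_add_left [symmetric])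

text \<open>Up to an overall sign, this is the condition \<open>m_scale\<close> for the bracket with
  \<open>f\<close> in the first argument. It comes from the Leibniz rule for \<open>lie\<close> in
  its first argument.\<close>

lemma bracket_vec_scale:
  "bracket_vec (scaleA a y) f \<approx> sm a (bracket_vec y f) - bracket_fun a (parity f) * wd [y]"
proof (induction f rule: free_alg_induct)
  case (mono b w)
  let ?g = "\<lambda>x. wd [lie (scaleA a y) x]"
  have lie: "?g x \<approx> sm a (wd [lie y x]) - sm (anchor x a) (wd [y])" for x
  proof -
    have "?g x \<approx> wd [scaleA a (lie y x)] + wd [scaleA (- anchor x a) y]"
      using letter_add [of "scaleA a (lie y x)" "scaleA (- anchor x a) y"]
      by (simp add: lie_scale_left)
    also have "\<dots> \<approx> sm a (wd [lie y x]) + sm (- anchor x a) (wd [y])"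
      by (intro cong_add letter_scale)
    finally show ?thesis
      by (simp add: minus_sm [symmetric])
  qed
  \<comment> \<open>The letter \<open>y\<close> is carried to the right end past
    \<open>length w - 1\<close> letters; the resulting sign is what the involution
    \<open>parity\<close> accounts for.\<close>
  have swap: "sm (sg (int j) * anchor (w ! j) a) (wd (y # om j w)) \<approx>
      sm (sg (int (length w) + int j + 1) * anchor (w ! j) a) (wd (om j w @ [y]))" if "j < length w" for j
  proof -
    have "sm (sg (int j) * anchor (w ! j) a) (wd ([] @ y # om j w)) \<approx>
      sm (sg (int j) * anchor (w ! j) a) (sm (sg (int (length (om j w)))) (wd ([] @ om j w @ [y])))"
      by (intro cong_sm letter_wd_comm)
    moreover have "sg (int j) * anchor (w ! j) a * sg (int (length (om j w))) =
        sg (int (length w) + int j + 1) * anchor (w ! j) a"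
      using that by (simp add: length_om mult.commute mult.left_commute) (auto simp: sg_def)
    ultimately show ?thesis by simp
  qed
  have "insertion_sum ?g w \<approx>
      (\<Sum>j<length w. sm (sg (int j)) ((sm a (wd [lie y (w ! j)]) - sm (anchor (w ! j) a) (wd [y])) * wd (om j w)))"
    unfolding insertion_sum_def by (intro cong_intros lie cong_refl)
  also have "\<dots> = sm a (insertion_sum (\<lambda>x. wd [lie y x]) w)
      - (\<Sum>j<length w. sm (sg (int j) * anchor (w ! j) a) (wd (y # om j w)))"
    by (simp add: insertion_sum_def sm_sum left_diff_distrib sm_diff sum_subtractf mult.commute)
  also have "\<dots> \<approx> sm a (insertion_sum (\<lambda>x. wd [lie y x]) w)
      - (\<Sum>j<length w. sm (sg (int (length w) + int j + 1) * anchor (w ! j) a) (wd (om j w @ [y])))"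
    by (intro cong_intros swap cong_refl) simp
  also have "\<dots> = sm a (insertion_sum (\<lambda>x. wd [lie y x]) w)
      - sm (sg (int (length w))) (insertion_sum (\<lambda>x. sm (- anchor x a) 1) w * wd [y])"
    by (simp add: insertion_sum_def sm_sum sum_distrib_right sg_shift ac_simps)
  finally have "sm (a * anchor y b) (wd w) + sm b (insertion_sum ?g w) \<approx> sm (a * anchor y b) (wd w)
      + sm b (sm a (insertion_sum (\<lambda>x. wd [lie y x]) w)
      - sm (sg (int (length w))) (insertion_sum (\<lambda>x. sm (- anchor x a) 1) w * wd [y]))"
    by (intro cong_intros cong_refl)
  then show ?case
    unfolding bracket_vec_def bracket_fun_def parity_sm_wd antider_sm_wd [OF additive_anchor]
      antider_sm_wd [OF additive_zero]
    by (simp add: anchor_scale sm_add sm_diff algebra_simps)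
next
  case (add f g)
  then show ?case
    using cong_add [OF add]
    by (simp add: additive.add [OF additive_bracket_vec] additive.add [OF additive_bracket_fun]
        additive.add [OF additive_parity] algebra_simps sm_add)
qed (simp add: additive.zero [OF additive_bracket_vec] additive.zero [OF additive_bracket_fun]
        additive.zero [OF additive_parity])

lemma additive_ad_fun: "additive (ad_fun P)"
proof
  fix a b
  show "ad_fun P (a + b) = ad_fun P a + ad_fun P b"
    using bracket_fun_lincomb [of "a + b" 1 a 1 b] by (simp add: ad_fun_def anchor_linear)
qed

lemma twisted_derivation_ad: "twisted_derivation scaleA (ad_fun P) (ad_vec P)"
proof
  show "ad_fun P (x + y) = ad_fun P x + ad_fun P y" for x y
    by (rule additive.add [OF additive_ad_fun])
  show "ad_fun P (a * b) \<approx> sm b (ad_fun P a) + sm a (ad_fun P b)" for a b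
    using bracket_fun_lincomb [of "a * b" b a a b] by (simp add: ad_fun_def anchor_mult ac_simps)
  show "ad_vec P (scaleA a x) \<approx> ad_fun P a * wd [x] + sm a (ad_vec P x)" for a x
    using cong_minus [OF bracket_vec_scale [of a x P]] by (simp add: ad_fun_def ad_vec_def minus_sm [symmetric])
  fix x y
  \<comment> \<open>The letter \<open>lie (x + y) z\<close> splits only modulo the ideal. The data
    are therefore first replaced by congruent ones, to which exact linearity in the data
    applies.\<close>
  have "bracket_vec (x + y) P \<approx>
      antider (\<lambda>b. sm (anchor x b) 1 + sm (anchor y b) 1) (\<lambda>z. wd [lie x z] + wd [lie y z]) P"
    unfolding bracket_vec_def
    by (rule antider_cong)
      (auto simp: additive_def anchor_linear sm_add_left anchor_add lie_add letter_add)
  also have "\<dots> = sm 1 (bracket_vec x P) + sm 1 (bracket_vec y P)"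
    unfolding bracket_vec_def
    by (rule antider_lincomb) (auto simp: additive_def anchor_linear sm_add_left)
  finally show "ad_vec P (x + y) \<approx> ad_vec P x + ad_vec P y"
    using cong_minus by (fastforce simp: ad_vec_def)
qed

section \<open>Bilinearity over \<open>K\<close> and descent to the exterior algebra\<close>

lemma additive_bracket: "additive (bracket P)"
  unfolding bracket_def by (rule additive_antider [OF additive_ad_fun])

lemma bracket_add_left: "bracket (P + Q) f = bracket P f + bracket Q f"
proof -
  have "bracket (P + Q) f = sm 1 (bracket P f) + sm 1 (bracket Q f)"
    unfolding bracket_def
    by (rule antider_lincomb)
      (simp_all add: additive_ad_fun ad_fun_def ad_vec_def additive.add [OF additive_bracket_vec]
        additive.add [OF additive_bracket_fun] additive.add [OF additive_parity] minus_sm [symmetric])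
  then show ?thesis by simp
qed

text \<open>Coefficients from \<open>A\<close> are differentiated, but those coming from
  \<open>K\<close> pass through as soon as \<open>n\<close> respects them.\<close>

lemma sm_constant_antider:
  assumes "additive n" "\<And>a. n (scaleK c 1 * a) = sm (scaleK c 1) (n a)"
  shows "antider n m (sm (scaleK c 1) f) = sm (scaleK c 1) (antider n m f)"
proof (induction f rule: free_alg_induct)
  case (mono a w)
  show ?case
    by (simp add: antider_sm_wd assms sm_add)
qed (simp_all add: additive.zero [OF additive_antider] additive.add [OF additive_antider] assms(1) sm_add)

lemma anchor_const_mult: "anchor x (scaleK c 1 * a) = scaleK c 1 * anchor x a"
  by (simp add: anchor_mult anchor_const)

lemma parity_sm: "parity (sm a f) = sm a (parity f)"
  by (induction f rule: free_alg_induct)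
    (simp_all add: parity_sm_wd sm_add additive.zero [OF additive_parity] additive.add [OF additive_parity] ac_simps)

lemma bracket_sm_right: "bracket P (sm (scaleK c 1) f) = sm (scaleK c 1) (bracket P f)"
  unfolding bracket_def
proof (rule sm_constant_antider [OF additive_ad_fun])
  fix a
  show "ad_fun P (scaleK c 1 * a) = sm (scaleK c 1) (ad_fun P a)"
    using bracket_fun_lincomb [of "scaleK c 1 * a" "scaleK c 1" a 0 0]
    by (simp add: ad_fun_def anchor_const_mult)
qed

lemma bracket_sm_left: "bracket (sm (scaleK c 1) P) f = sm (scaleK c 1) (bracket P f)"
proof -
  have "bracket_vec y (sm (scaleK c 1) P) = sm (scaleK c 1) (bracket_vec y P)" for y
    unfolding bracket_vec_def by (rule sm_constant_antider) (simp_all add: additive_anchor anchor_const_mult)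
  moreover have "bracket_fun y (sm (scaleK c 1) g) = sm (scaleK c 1) (bracket_fun y g)" for y g
    unfolding bracket_fun_def by (rule sm_constant_antider) (simp_all add: additive_zero)
  \<comment> \<open>The summand with coefficient 0 only brings the claim into the shape of a
    combination of two sets of data.\<close>
  ultimately have "bracket (sm (scaleK c 1) P) f = sm (scaleK c 1) (bracket P f) + sm 0 (bracket P f)"
    unfolding bracket_def
    by (intro antider_lincomb) (simp_all add: additive_ad_fun ad_fun_def ad_vec_def parity_sm minus_sm)
  then show ?thesis by simp
qed

lemma bracket_zero_left: "bracket 0 f = 0"
  using bracket_add_left [of 0 0 f] by simp

text \<open>The involution and the operators \<open>[a, .]\<close> and \<open>[y, .]\<close>
  preserve the ideal, so the data of \<open>bracket P\<close> vanish modulo the ideal when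
  \<open>P\<close> lies in it.\<close>

lemma bracket_I_left: "P \<in> I \<Longrightarrow> bracket P f \<in> I"
proof -
  assume P: "P \<in> I"
  have "ad_fun P a \<approx> ad_fun 0 a" for a
    using twisted_derivation.D_cong [OF twisted_derivation_fun, of "parity P" "parity 0"] parity_I [OF P]
    by (simp add: ad_fun_def bracket_fun_def additive.zero [OF additive_parity] cong_0_iff)
  moreover have "ad_vec P y \<approx> ad_vec 0 y" for y
    using twisted_derivation.D_cong [OF twisted_derivation_vec, of P 0] P
    by (simp add: ad_vec_def bracket_vec_def cong_0_iff cong_minus)
  ultimately have "bracket P f \<approx> bracket 0 f"
    unfolding bracket_def by (intro antider_cong additive_ad_fun)
  then show ?thesis by (simp add: bracket_zero_left cong_0_iff)
qed

lemma bracket_cong: assumes "P \<approx> P'" "Q \<approx> Q'" shows "bracket P Q \<approx> bracket P' Q'"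
proof -
  have "bracket P Q \<approx> bracket P Q'"
    unfolding bracket_def by (rule twisted_derivation.D_cong [OF twisted_derivation_ad assms(2)])
  also have "bracket P Q' \<approx> bracket P' Q'"
    using bracket_I_left [of "P - P'" Q'] bracket_add_left [of "P - P'" P' Q'] assms(1)
    by (simp add: cong_def)
  finally show ?thesis .
qed

section \<open>Degree, antisymmetry and the two Leibniz rules\<close>

lemma homog_1: "homog 0 1"
  by (simp add: homog_def zero_list_def)

lemma homog_bracket:
  assumes "homog p P" "homog q Q" shows "homog (p + q - 1) (bracket P Q)"
proof -
  have "homog (p + - 1) (ad_fun P a)" for a
    unfolding ad_fun_def bracket_fun_def parity_homog [OF assms(1)]
    by (rule homog_antider)
      (use assms in \<open>simp_all add: additive_zero homog_sm homog_1\<close>)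
  moreover have "homog (p + 0) (ad_vec P y)" for y
    unfolding ad_vec_def bracket_vec_def
    by (intro homog_minus homog_antider)
      (use assms in \<open>simp_all add: additive_anchor homog_sm homog_1\<close>)
  ultimately have "homog (q + (p - 1)) (bracket P Q)"
    unfolding bracket_def by (intro homog_antider additive_ad_fun assms) simp_all
  then show ?thesis by (simp add: algebra_simps)
qed

text \<open>The explicit formula from which both the antisymmetry and the prescribed values are read
  off: letters of \<open>xs\<close> differentiate \<open>b\<close>, letters of \<open>ys\<close>
  differentiate \<open>a\<close>, and pairs of letters are bracketed.\<close>

lemma bracket_monomials:
  "bracket (sm a (wd xs)) (sm b (wd ys)) \<approx>
     (\<Sum>i<length xs. sm (sg (int (length xs) + int i + 1) * (a * anchor (xs ! i) b)) (wd (om i xs @ ys)))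
     - (\<Sum>j<length ys. sm (sg (int j) * (b * anchor (ys ! j) a)) (wd (xs @ om j ys)))
     + (\<Sum>j<length ys. \<Sum>i<length xs.
          sm (sg (int i + int j) * (a * b)) (wd (lie (xs ! i) (ys ! j) # om i xs @ om j ys)))"
proof -
  have lie: "wd (lie y x # w) \<approx> - wd (lie x y # w)" for x y w
    using wd_minus [of "lie x y" w] lie_commute [of y x] by simp
  have "bracket (sm a (wd xs)) (sm b (wd ys)) =
     (\<Sum>i<length xs. sm (sg (int (length xs) + int i + 1) * (a * anchor (xs ! i) b)) (wd (om i xs @ ys)))
     - (\<Sum>j<length ys. sm (sg (int j) * (b * anchor (ys ! j) a)) (wd (xs @ om j ys)))
     - (\<Sum>j<length ys. \<Sum>i<length xs.
          sm (sg (int i + int j) * (a * b)) (wd (lie (ys ! j) (xs ! i) # om i xs @ om j ys)))"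
    by (simp add: bracket_def antider_sm_wd additive_ad_fun ad_fun_def ad_vec_def bracket_fun_def
        bracket_vec_def parity_sm_wd additive_zero additive_anchor insertion_sum_def sm_sum sm_add sm_diff
        sum_distrib_right sum_distrib_left sum_subtractf sum.distrib sg_shift minus_sm [symmetric]
        sum_negf algebra_simps)
  also have "\<dots> \<approx> (\<Sum>i<length xs. sm (sg (int (length xs) + int i + 1) * (a * anchor (xs ! i) b)) (wd (om i xs @ ys)))
     - (\<Sum>j<length ys. sm (sg (int j) * (b * anchor (ys ! j) a)) (wd (xs @ om j ys)))
     - (\<Sum>j<length ys. \<Sum>i<length xs.
          sm (sg (int i + int j) * (a * b)) (- wd (lie (xs ! i) (ys ! j) # om i xs @ om j ys)))"
    by (intro cong_intros lie cong_refl)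
  finally show ?thesis
    by (simp add: minus_sm [symmetric] sum_negf)
qed


text \<open>Exchanging the arguments swaps the two anchor sums of the explicit formula and maps the
  double sum to itself. What remains is to compare, term by term, the sign of moving the leftover
  words past each other.\<close>

lemma bracket_antisym_monomials:
  assumes "int (length xs) = p" "int (length ys) = q"
  shows "bracket (sm a (wd xs)) (sm b (wd ys)) \<approx> - sm (sg ((p - 1) * (q - 1))) (bracket (sm b (wd ys)) (sm a (wd xs)))"
proof -
  let ?s = "sg ((p - 1) * (q - 1)) :: 'a"
  have comm: "sm c (wd (u @ v)) \<approx> sm (c * sg (int (length u) * int (length v))) (wd (v @ u))" for c u v
    using cong_sm [OF wd_comm [of u v], of c] by simp
  have 1: "sm (sg (p + int i + 1) * (a * anchor (xs ! i) b)) (wd (om i xs @ ys)) \<approx>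
      sm (?s * (sg (int i) * (a * anchor (xs ! i) b))) (wd (ys @ om i xs))" if "i < length xs" for i
  proof -
    have "sg (p + int i + 1) * sg ((p - 1) * q) = (?s * sg (int i) :: 'a)"
      by (simp, rule sg_eqI) (auto simp: algebra_simps)
    then have "sg (p + int i + 1) * (a * anchor (xs ! i) b) * sg ((p - 1) * q) = ?s * (sg (int i) * (a * anchor (xs ! i) b))"
      by (metis (no_types, opaque_lifting) mult.assoc mult.commute)
    then show ?thesis
      using comm [of "sg (p + int i + 1) * (a * anchor (xs ! i) b)" "om i xs" ys] assms that
      by (simp only: length_om)
  qed
  have 2: "sm (sg (int j) * (b * anchor (ys ! j) a)) (wd (xs @ om j ys)) \<approx>
      sm (?s * (sg (q + int j + 1) * (b * anchor (ys ! j) a))) (wd (om j ys @ xs))" if "j < length ys" for j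
  proof -
    have "sg (int j) * sg (p * (q - 1)) = (?s * sg (q + int j + 1) :: 'a)"
      by (simp, rule sg_eqI) (auto simp: algebra_simps)
    then have "sg (int j) * (b * anchor (ys ! j) a) * sg (p * (q - 1)) = ?s * (sg (q + int j + 1) * (b * anchor (ys ! j) a))"
      by (metis (no_types, opaque_lifting) mult.assoc mult.commute)
    then show ?thesis
      using comm [of "sg (int j) * (b * anchor (ys ! j) a)" xs "om j ys"] assms that
      by (simp only: length_om)
  qed
  have 3: "sm (sg (int i + int j) * (a * b)) (wd (lie (xs ! i) (ys ! j) # om i xs @ om j ys)) \<approx>
      - sm (?s * (sg (int j + int i) * (b * a))) (wd (lie (ys ! j) (xs ! i) # om j ys @ om i xs))"
    if "i < length xs" "j < length ys" for i j
  proof -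
    have "wd (lie (xs ! i) (ys ! j) # om i xs @ om j ys) \<approx> - wd (lie (ys ! j) (xs ! i) # om i xs @ om j ys)"
      using wd_minus [of "lie (ys ! j) (xs ! i)"] lie_commute [of "xs ! i"] by simp
    also have "\<dots> \<approx> - (letter (lie (ys ! j) (xs ! i)) * sm ?s (wd (om j ys @ om i xs)))"
      using cong_minus [OF cong_mult [OF cong_refl wd_comm [of "om i xs" "om j ys"]],
          of "letter (lie (ys ! j) (xs ! i))"] assms that by (simp add: length_om)
    finally show ?thesis
      using cong_sm [of _ _ "sg (int i + int j) * (a * b)"]
      by (fastforce simp: minus_sm ac_simps)
  qed
  have "bracket (sm a (wd xs)) (sm b (wd ys)) \<approx>
     (\<Sum>i<length xs. sm (sg (p + int i + 1) * (a * anchor (xs ! i) b)) (wd (om i xs @ ys)))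
     - (\<Sum>j<length ys. sm (sg (int j) * (b * anchor (ys ! j) a)) (wd (xs @ om j ys)))
     + (\<Sum>j<length ys. \<Sum>i<length xs.
          sm (sg (int i + int j) * (a * b)) (wd (lie (xs ! i) (ys ! j) # om i xs @ om j ys)))"
    using bracket_monomials [of a xs b ys] assms by simp
  also have "\<dots> \<approx>
     (\<Sum>i<length xs. sm (?s * (sg (int i) * (a * anchor (xs ! i) b))) (wd (ys @ om i xs)))
     - (\<Sum>j<length ys. sm (?s * (sg (q + int j + 1) * (b * anchor (ys ! j) a))) (wd (om j ys @ xs)))
     + (\<Sum>j<length ys. \<Sum>i<length xs.
          - sm (?s * (sg (int j + int i) * (b * a))) (wd (lie (ys ! j) (xs ! i) # om j ys @ om i xs)))"
    by (intro cong_add cong_diff cong_sum 1 2 3) simp_all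
  also have "\<dots> = - sm ?s (
     (\<Sum>j<length ys. sm (sg (q + int j + 1) * (b * anchor (ys ! j) a)) (wd (om j ys @ xs)))
     - (\<Sum>i<length xs. sm (sg (int i) * (a * anchor (xs ! i) b)) (wd (ys @ om i xs)))
     + (\<Sum>i<length xs. \<Sum>j<length ys.
          sm (sg (int j + int i) * (b * a)) (wd (lie (ys ! j) (xs ! i) # om j ys @ om i xs))))"
    unfolding sm_add sm_diff sm_sum sm_sm sum_negf sum.swap [of _ "{..<length xs}"] by simp
  also have "\<dots> \<approx> - sm ?s (bracket (sm b (wd ys)) (sm a (wd xs)))"
    by (intro cong_minus cong_sm cong_sym [OF bracket_monomials [of b ys a xs, unfolded assms]])
  finally show ?thesis .
qed

lemma bracket_antisym:
  assumes "homog p P" "homog q Q"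
  shows "bracket P Q \<approx> - sm (sg ((p - 1) * (q - 1))) (bracket Q P)"
  using assms(1)
proof (induction P rule: homog_induct)
  case (mono a w)
  from assms(2) show ?case
  proof (induction Q rule: homog_induct)
    case (mono b v)
    with \<open>int (length w) = p\<close> show ?case
      by (intro bracket_antisym_monomials)
  next
    case (add f g)
    then show ?case
      using cong_add [OF add]
      by (simp add: additive.add [OF additive_bracket] bracket_add_left sm_add)
  qed (simp add: additive.zero [OF additive_bracket] bracket_zero_left)
next
  case (add f g)
  then show ?case
    using cong_add [OF add]
    by (simp add: additive.add [OF additive_bracket] bracket_add_left sm_add)
qed (simp add: additive.zero [OF additive_bracket] bracket_zero_left)

text \<open>Moving \<open>bracket P R\<close>, of degree \<open>p + r - 1\<close>, past
  \<open>Q\<close> changes the exponent \<open>q * r\<close> into \<open>(p - 1) * q\<close> modulo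
  2.\<close>

lemma bracket_mult_right:
  assumes "homog p P" "homog q Q" "homog r R"
  shows "bracket P (Q * R) \<approx> bracket P Q * R + sm (sg ((p - 1) * q)) (Q * bracket P R)"
proof -
  have "bracket P (Q * R) \<approx> bracket P Q * R + sm (sg (q * r)) (bracket P R * Q)"
    unfolding bracket_def by (rule twisted_derivation.D_mult [OF twisted_derivation_ad assms(2,3)])
  also have "\<dots> \<approx> bracket P Q * R + sm (sg (q * r)) (sm (sg ((p + r - 1) * q)) (Q * bracket P R))"
    by (intro cong_add cong_sm homog_comm homog_bracket assms cong_refl)
  also have "sm (sg (q * r)) (sm (sg ((p + r - 1) * q)) (Q * bracket P R)) = sm (sg ((p - 1) * q)) (Q * bracket P R)"
    by simp (rule arg_cong [of _ _ "\<lambda>c. sm c _"], rule sg_eqI, simp add: algebra_simps)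
  finally show ?thesis .
qed

lemma bracket_mult_left:
  assumes "homog p P" "homog q Q" "homog r R"
  shows "bracket (P * Q) R \<approx> P * bracket Q R + sm (sg (q * (r - 1))) (bracket P R * Q)"
proof -
  have "bracket (P * Q) R \<approx> - sm (sg ((p + q - 1) * (r - 1))) (bracket R (P * Q))"
    by (rule bracket_antisym [OF homog_mult [OF assms(1,2)] assms(3)])
  also have "\<dots> \<approx> - sm (sg ((p + q - 1) * (r - 1))) (bracket R P * Q + sm (sg ((r - 1) * p)) (P * bracket R Q))"
    by (intro cong_minus cong_sm bracket_mult_right [OF assms(3,1,2)])
  also have "\<dots> \<approx> - sm (sg ((p + q - 1) * (r - 1))) ((- sm (sg ((r - 1) * (p - 1))) (bracket P R)) * Q
      + sm (sg ((r - 1) * p)) (P * (- sm (sg ((r - 1) * (q - 1))) (bracket Q R))))"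
    by (intro cong_intros bracket_antisym assms cong_refl)
  also have "\<dots> = sm (sg ((p + q - 1) * (r - 1) + (r - 1) * (p - 1))) (bracket P R * Q)
      + sm (sg ((p + q - 1) * (r - 1) + ((r - 1) * p + (r - 1) * (q - 1)))) (P * bracket Q R)"
    by (simp add: sm_add sm_diff minus_sm [symmetric])
  \<comment> \<open>Both exponents are multiples of \<open>r - 1\<close>: this one by
    \<open>2 * p + q - 2\<close>, the next one by the even number
    \<open>2 * p + 2 * q - 2\<close>.\<close>
  also have "sg ((p + q - 1) * (r - 1) + (r - 1) * (p - 1)) = (sg (q * (r - 1)) :: 'a)"
    by (rule sg_eqI) (simp add: algebra_simps)
  also have "sg ((p + q - 1) * (r - 1) + ((r - 1) * p + (r - 1) * (q - 1))) = (sg 0 :: 'a)"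
    by (rule sg_eqI) (simp add: algebra_simps)
  finally show ?thesis
    by (simp add: add.commute)
qed

section \<open>The Schouten--Nijenhuis bracket\<close>

definition class_bracket ::
    "('g, 'a) free_alg set \<Rightarrow> ('g, 'a) free_alg set \<Rightarrow> ('g, 'a) free_alg set" where
  "class_bracket U V = cls (bracket (SOME f. U = cls f) (SOME g. V = cls g))"

text \<open>The chosen representatives are congruent to \<open>f\<close> and \<open>g\<close>, and
  the bracket respects congruence in both arguments.\<close>

lemma class_bracket_cls: "class_bracket (cls f) (cls g) = cls (bracket f g)"
proof -
  have "(SOME h. cls f = cls h) \<approx> f" for f
    using someI [of "\<lambda>h. cls f = cls h" f] by (simp add: cls_eq_iff cong_sym)
  then show ?thesis
    unfolding class_bracket_def by (simp only: cls_eq_iff bracket_cong)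
qed

section \<open>Existence and uniqueness of the bracket on the exterior algebra\<close>

lemma scaleK_sg: "scaleK (sg k) 1 = sg k"
  by (simp add: sg_def)

lemma schouten_bracket_exists: "is_schouten_bracket scaleK scaleA lie anchor class_bracket"
proof -
  have lin: "ext_K_linear scaleK scaleA (class_bracket U)" if U: "U \<in> carrier E" for U
    using U by (auto simp: ext_K_linear_def Let_def carrier_E cls_add ext_scaleK_cls class_bracket_cls
        additive.add [OF additive_bracket] bracket_sm_right)
  have lin': "ext_K_linear scaleK scaleA (\<lambda>U. class_bracket U V)" if V: "V \<in> carrier E" for V
    using V by (auto simp: ext_K_linear_def Let_def carrier_E cls_add ext_scaleK_cls class_bracket_cls
        bracket_add_left bracket_sm_left)
  have words: "class_bracket (wedge_list scaleA xs) (wedge_list scaleA ys) =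
      (\<Oplus>\<^bsub>E\<^esub>i\<in>{1..length xs}. \<Oplus>\<^bsub>E\<^esub>j\<in>{1..length ys}.
         ext_scale scaleA ((-1) ^ (i + j))
           (ext_vec scaleA (lie (xs ! (i - 1)) (ys ! (j - 1))) \<otimes>\<^bsub>E\<^esub>
              wedge_list scaleA (omit i xs) \<otimes>\<^bsub>E\<^esub> wedge_list scaleA (omit j ys)))" for xs ys
  proof -
    \<comment> \<open>With both coefficients equal to 1 the two anchor sums vanish. Counting
      positions from 1 instead of 0 adds 2 to the exponent and leaves the sign unchanged.\<close>
    have "bracket (wd xs) (wd ys) \<approx> (\<Sum>i<length xs. \<Sum>j<length ys.
          sm (sg (int i + int j)) (wd (lie (xs ! i) (ys ! j) # om i xs @ om j ys)))"
      using bracket_monomials [of 1 xs 1 ys] by (simp add: anchor_1 sum.swap [of _ "{..<length xs}"])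
    then show ?thesis
      by (simp add: wedge_list_cls class_bracket_cls ext_vec_cls ext_scale_cls cls_mult cls_sum
          sum.atLeast1_atMost_eq cls_eq_iff power_minus1_sg omit_Suc sg_add_2)
  qed
  have right: "class_bracket (wedge_list scaleA xs) (ext_const scaleA a) =
      (\<Oplus>\<^bsub>E\<^esub>i\<in>{1..length xs}. ext_scale scaleA ((-1) ^ (length xs - i) * anchor (xs ! (i - 1)) a)
         (wedge_list scaleA (omit i xs)))" for xs a
  proof -
    \<comment> \<open>The natural subtraction does not truncate for \<open>i < length xs\<close>, so
      the exponents agree modulo 2.\<close>
    have "sg (int (length xs - Suc i)) = (sg (int (length xs) + int i + 1) :: 'a)" if "i < length xs" for i
      using that by (intro sg_eqI) (auto simp: of_nat_diff)
    then have "(\<Sum>i<length xs. sm (sg (int (length xs) + int i + 1) * anchor (xs ! i) a) (wd (om i xs)))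
        = (\<Sum>i<length xs. sm (sg (int (length xs - Suc i)) * anchor (xs ! i) a) (wd (om i xs)))"
      by (intro sum.cong) auto
    then have "bracket (wd xs) (sm a (wd [])) \<approx>
        (\<Sum>i<length xs. sm (sg (int (length xs - Suc i)) * anchor (xs ! i) a) (wd (om i xs)))"
      using bracket_monomials [of 1 xs a "[]"] by simp
    then show ?thesis
      by (simp add: wedge_list_cls ext_const_cls class_bracket_cls ext_scale_cls cls_sum
          sum.atLeast1_atMost_eq cls_eq_iff power_minus1_sg omit_Suc)
  qed
  have left: "class_bracket (ext_const scaleA a) (wedge_list scaleA xs) =
      (\<Oplus>\<^bsub>E\<^esub>i\<in>{1..length xs}. ext_scale scaleA ((-1) ^ i * anchor (xs ! (i - 1)) a)
         (wedge_list scaleA (omit i xs)))" for xs a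
    \<comment> \<open>Only the second sum survives for an empty first word; its minus sign is
      absorbed by counting positions from 1.\<close>
    using bracket_monomials [of a "[]" 1 xs]
    by (simp add: wedge_list_cls ext_const_cls class_bracket_cls ext_scale_cls cls_sum
          sum.atLeast1_atMost_eq cls_eq_iff power_minus1_sg omit_Suc sg_shift minus_sm [symmetric] sum_negf)
  have const: "class_bracket (ext_const scaleA a) (ext_const scaleA b) = \<zero>\<^bsub>E\<^esub>" for a b
    using bracket_monomials [of a "[]" b "[]"]
    by (simp add: ext_const_cls class_bracket_cls cls_0 cls_eq_iff)
  show ?thesis
    unfolding is_schouten_bracket_def Let_def
    by (intro conjI ballI allI impI lin lin' words right left const)
qed

text \<open>By additivity in both arguments it suffices to compare monomials. A monomial is an
  element of \<open>A\<close> if its word is empty and decomposable otherwise, so the prescribed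
  values decide.\<close>

lemma schouten_bracket_unique:
  assumes "is_schouten_bracket scaleK scaleA lie anchor B"
    and "is_schouten_bracket scaleK scaleA lie anchor B'"
  shows "B (cls f) (cls g) = B' (cls f) (cls g)"
proof -
  have add: "C (cls (f + f')) (cls g) = C (cls f) (cls g) \<oplus>\<^bsub>E\<^esub> C (cls f') (cls g)"
    "C (cls g) (cls (f + f')) = C (cls g) (cls f) \<oplus>\<^bsub>E\<^esub> C (cls g) (cls f')"
    if "is_schouten_bracket scaleK scaleA lie anchor C" for C f f' g
    using that by (simp_all add: is_schouten_bracket_def ext_K_linear_def Let_def cls_add [symmetric])
  have mono: "B (cls (sm a (wd w))) (cls (sm b (wd v))) = B' (cls (sm a (wd w))) (cls (sm b (wd v)))" for a b w v
    using assms unfolding is_schouten_bracket_def Let_def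
    by (cases w; cases v) (simp_all add: cls_generator ext_const_cls [symmetric])
  note add = add [OF assms(1)] add [OF assms(2)]
  have left: "B (cls (sm a (wd w))) (cls g) = B' (cls (sm a (wd w))) (cls g)" for a w
    \<comment> \<open>The zero element is treated as the monomial with coefficient 0 and empty
      word.\<close>
    by (induction g rule: free_alg_induct) (use mono [of a w] mono [of a w 0 "[]"] in \<open>simp_all add: add\<close>)
  show ?thesis
    by (induction f rule: free_alg_induct) (use left left [of 0 "[]"] in \<open>simp_all add: add\<close>)
qed

lemma schouten_cls: "schouten scaleK scaleA lie anchor (cls f) (cls g) = cls (bracket f g)"
  unfolding schouten_def class_bracket_cls [symmetric]
  by (rule schouten_bracket_unique [OF someI [of "is_schouten_bracket scaleK scaleA lie anchor", OF schouten_bracket_exists] schouten_bracket_exists])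

end

theorem proposition3p7:
  fixes scaleK :: "'k::field_char_0 \<Rightarrow> 'a::comm_ring_1 \<Rightarrow> 'a"
    and scaleA :: "'a \<Rightarrow> 'g::ab_group_add \<Rightarrow> 'g"
    and lie :: "'g \<Rightarrow> 'g \<Rightarrow> 'g"
    and anchor :: "'g \<Rightarrow> 'a \<Rightarrow> 'a"
    and P Q R :: "('g, 'a) free_alg set"
    and p q r :: int
  assumes "lie_rinehart scaleK scaleA lie anchor"
    and "P \<in> ext_degree scaleA p"
    and "Q \<in> ext_degree scaleA q"
    and "R \<in> ext_degree scaleA r"
  shows "schouten scaleK scaleA lie anchor P (Q \<otimes>\<^bsub>exterior_algebra scaleA\<^esub> R) =
           (schouten scaleK scaleA lie anchor P Q \<otimes>\<^bsub>exterior_algebra scaleA\<^esub> R)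
           \<oplus>\<^bsub>exterior_algebra scaleA\<^esub>
           ext_scaleK scaleK scaleA ((-1) powi ((p - 1) * q))
             (Q \<otimes>\<^bsub>exterior_algebra scaleA\<^esub> schouten scaleK scaleA lie anchor P R)
       \<and> schouten scaleK scaleA lie anchor (P \<otimes>\<^bsub>exterior_algebra scaleA\<^esub> Q) R =
           (P \<otimes>\<^bsub>exterior_algebra scaleA\<^esub> schouten scaleK scaleA lie anchor Q R)
           \<oplus>\<^bsub>exterior_algebra scaleA\<^esub>
           ext_scaleK scaleK scaleA ((-1) powi (q * (r - 1)))
             (schouten scaleK scaleA lie anchor P R \<otimes>\<^bsub>exterior_algebra scaleA\<^esub> Q)"
proof -
  interpret lie_rinehart scaleK scaleA lie anchor by fact
  from assms(2-4) obtain f g h where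
    "P = cls f" "homog p f" "Q = cls g" "homog q g" "R = cls h" "homog r h"
    by (auto simp: ext_degree_cls)
  then show ?thesis
    by (simp add: cls_mult cls_add schouten_cls power_int_minus1_sg ext_scaleK_cls scaleK_sg cls_eq_iff
        bracket_mult_right bracket_mult_left)
qed

end
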